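(* The following equations, called the ``modified Schr\"odinger map'' (MSM) equations, follow from the Schr\"odinger map equation and consistency conditions (written out in the context, in the gauge with $\operatorname{div}a=0$) for $u_0,\dots,u_n$ and $a_0,\dots,a_n$: $$\frac{\partial u_j}{\partial t}=i\Delta u_j-2\sum_{k}a_k\frac{\partial u_j}{\partial x_k}-i\left(\sum_{k}a_k^2\right)u_j+2\sum_{k}\mathrm{Im}(\overline{u_j}u_k)\,u_k-ia_0u_j,\qquad j=1,\dots,n,$$ where $$a_k=\sum_{l=1}^n\frac{\partial\kappa_{lk}}{\partial x_l},\qquad d\kappa=0,$$ $$\Delta\kappa_{kj}=-4\,\mathrm{Im}(u_k\overline{u_j}),\qquad j=0,1,\dots,n,\ k=1,\dots,n,$$ $$\Delta a_0=-4\sum_{j=1}^n\sum_{k=1}^n\left[\frac{\partial}{\partial x_k}\frac{\partial}{\partial x_j}\mathrm{Re}(u_k\overline{u_j})-\frac12\left(\frac{\partial}{\partial x_k}\right)^2(u_j\overline{u_j})\right].$$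
   Context: The index $0$ denotes time, $x_0=t$; sums over $k$ without limits run over $k=1,\dots,n$; $\Delta$ is the Laplacian in the space variables. The complex-valued functions $u_j$ and real-valued functions $a_j$ on $\mathbb R\times\mathbb R^n$, $j=0,1,\dots,n$, come from a sufficiently smooth, finite energy Schr\"odinger map $s:\mathbb R\times\mathbb R^n\to\mathbb C\cup\{\infty\}=\mathbb S^2$ (stereographic projection) with $s\to0$ at spatial infinity, i.e. a solution of $\partial_ts=i\sum_{j=1}^n\nabla_j\partial_{x_j}s$ with $\nabla_j=\partial_{x_j}-2\overline{s}\,(\partial_{x_j}s)/(1+|s|^2)$, through $$u_j=(1+|s|^2)^{-1}e^{i\psi}\partial_{x_j}s,\qquad D_j=(1+|s|^2)^{-1}e^{i\psi}\circ\nabla_j\circ(1+|s|^2)e^{-i\psi}=\partial_{x_j}+ia_j,$$ where the real function $\psi$ is chosen so that $\operatorname{div}a=\sum_{j=1}^n\partial_{x_j}a_j=0$ and $a\sim0$ at infinity. In these terms the Schr\"odinger map equation is $$u_0=i\sum_{j=1}^nD_ju_j,$$ and the consistency conditions are, for $j=0,1,\dots,n$ and $k=1,\dots,n$, $$D_ju_k=D_ku_j,\qquad [D_j,D_k]=i\left(\frac{\partial a_k}{\partial x_j}-\frac{\partial a_j}{\partial x_k}\right)=-4i\,\mathrm{Im}(u_j\overline{u_k}).$$ Here $\kappa=(\kappa_{kj})$ is a real 2-form (antisymmetric in its indices) and $d$ is the exterior derivative.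
   Formalization: The curvature sign is corrected to [D_j,D_k]=+4i Im(u_j ū_k), as the definitions give; so the cubic term has coefficient 4, not 2, and Δκ_{kj}=+4 Im(u_k ū_j), not −4; "a∼0 at infinity" is read as decay of a_0,…,a_n and their derivatives up to order 3. *)

theory Defs
  imports "HOL-Analysis.Analysis"
begin

text \<open>Points \<open>(t, x)\<close> of \<open>\<real> \<times> \<real>\<^sup>n\<close>. An index in \<open>{0, 1, ..., n}\<close> is an element of \<open>'n option\<close>:
  \<open>None\<close> is the time index \<open>0\<close>, and \<open>Some j\<close> is the space index \<open>j\<close>.\<close>

type_synonym 'n spacetime = "real \<times> (real ^ 'n)"

fun dir :: "'n::finite option \<Rightarrow> 'n spacetime" where
  "dir None = (1, 0)"
| "dir (Some j) = (0, axis j 1)"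

definition pd :: "'n::finite option \<Rightarrow> ('n spacetime \<Rightarrow> 'b::real_normed_vector) \<Rightarrow> 'n spacetime \<Rightarrow> 'b" where
  "pd i f z = vector_derivative (\<lambda>h. f (z + h *\<^sub>R dir i)) (at 0)"

text \<open>The Laplacian in the space variables only.\<close>

definition lap :: "('n::finite spacetime \<Rightarrow> 'b::real_normed_vector) \<Rightarrow> 'n spacetime \<Rightarrow> 'b" where
  "lap f z = (\<Sum>k\<in>UNIV. pd (Some k) (pd (Some k) f) z)"

text \<open>Class \<open>C\<^sup>m\<close> in all \<open>n + 1\<close> variables, meant for open \<open>S\<close>.\<close>

fun Cm_on :: "nat \<Rightarrow> 'n::finite spacetime set \<Rightarrow> ('n spacetime \<Rightarrow> 'b::real_normed_vector) \<Rightarrow> bool" where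
  "Cm_on 0 S f \<longleftrightarrow> continuous_on S f"
| "Cm_on (Suc m) S f \<longleftrightarrow> f differentiable_on S \<and> (\<forall>i. Cm_on m S (pd i f))"

text \<open>Decay as the space variable tends to infinity, locally uniformly in \<open>t\<close>; then the same for
  all derivatives of order at most \<open>m\<close>.\<close>

definition vanishes_at_infinity :: "('n::finite spacetime \<Rightarrow> 'b::real_normed_vector) \<Rightarrow> bool" where
  "vanishes_at_infinity f \<longleftrightarrow>
     (\<forall>T. \<forall>e>0. \<exists>R. \<forall>t x. \<bar>t\<bar> \<le> T \<longrightarrow> R \<le> norm x \<longrightarrow> norm (f (t, x)) < e)"

fun Cm_vanishes_at_infinity :: "nat \<Rightarrow> ('n::finite spacetime \<Rightarrow> 'b::real_normed_vector) \<Rightarrow> bool" where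
  "Cm_vanishes_at_infinity 0 f \<longleftrightarrow> vanishes_at_infinity f"
| "Cm_vanishes_at_infinity (Suc m) f \<longleftrightarrow>
     vanishes_at_infinity f \<and> (\<forall>i. Cm_vanishes_at_infinity m (pd i f))"

text \<open>The conformal factor \<open>1 + |s|\<^sup>2\<close> of the stereographic chart, as a complex number.\<close>

definition conf :: "('n::finite spacetime \<Rightarrow> complex) \<Rightarrow> 'n spacetime \<Rightarrow> complex" where
  "conf s z = of_real (1 + (cmod (s z))\<^sup>2)"

text \<open>The pullback by \<open>s\<close> of the Levi-Civita connection of the sphere.\<close>

definition nabla :: "('n::finite spacetime \<Rightarrow> complex) \<Rightarrow> 'n option
    \<Rightarrow> ('n spacetime \<Rightarrow> complex) \<Rightarrow> 'n spacetime \<Rightarrow> complex" where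
  "nabla s i w z = pd i w z - 2 * cnj (s z) * pd i s z / conf s z * w z"

definition schroedinger_map_on :: "'n::finite spacetime set \<Rightarrow> ('n spacetime \<Rightarrow> complex) \<Rightarrow> bool" where
  "schroedinger_map_on U s \<longleftrightarrow>
     (\<forall>z\<in>U. pd None s z = \<i> * (\<Sum>j\<in>UNIV. nabla s (Some j) (pd (Some j) s) z))"

definition covD :: "('n::finite option \<Rightarrow> 'n spacetime \<Rightarrow> real) \<Rightarrow> 'n option
    \<Rightarrow> ('n spacetime \<Rightarrow> complex) \<Rightarrow> 'n spacetime \<Rightarrow> complex" where
  "covD a i w z = pd i w z + \<i> * of_real (a i z) * w z"

text \<open>\<open>u\<close> and \<open>a\<close> are the derivatives of \<open>s\<close> and the connection coefficients in the frame given by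
  the phase \<open>\<psi>\<close>. The second clause is the operator identity
  \<open>(1 + |s|\<^sup>2)\<^sup>-\<^sup>1 e\<^sup>i\<^sup>\<psi> \<circ> \<nabla>\<^sub>i \<circ> (1 + |s|\<^sup>2) e\<^sup>-\<^sup>i\<^sup>\<psi> = \<partial>\<^sub>i + i a\<^sub>i\<close>.\<close>

definition frame_fields_on :: "'n::finite spacetime set \<Rightarrow> ('n spacetime \<Rightarrow> complex)
    \<Rightarrow> ('n spacetime \<Rightarrow> real) \<Rightarrow> ('n option \<Rightarrow> 'n spacetime \<Rightarrow> complex)
    \<Rightarrow> ('n option \<Rightarrow> 'n spacetime \<Rightarrow> real) \<Rightarrow> bool" where
  "frame_fields_on U s \<psi> u a \<longleftrightarrow>
     (\<forall>i. \<forall>z\<in>U. u i z = exp (\<i> * of_real (\<psi> z)) / conf s z * pd i s z) \<and>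
     (\<forall>i. \<forall>z\<in>U. \<forall>w. w differentiable (at z) \<longrightarrow>
        exp (\<i> * of_real (\<psi> z)) / conf s z
          * nabla s i (\<lambda>y. conf s y * exp (- \<i> * of_real (\<psi> y)) * w y) z
        = covD a i w z)"

end

theory Submission
  imports Defs
begin

text \<open>
  The first and the third claim are algebra in the moving frame. The frame turns three geometric
  facts about \<open>s\<close> into identities for \<open>u\<close> and \<open>a\<close>: the pulled back connection has no torsion,
  \<open>D\<^sub>i u\<^sub>k = D\<^sub>k u\<^sub>i\<close>; its curvature is that of the sphere,
  \<open>\<partial>\<^sub>i a\<^sub>j - \<partial>\<^sub>j a\<^sub>i = 4 Im (u\<^sub>i cnj u\<^sub>j)\<close>; and the equation reads \<open>u\<^sub>0 = \<i> \<Sum> D\<^sub>k u\<^sub>k\<close>.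
  All three are computed on \<open>U\<close>, where \<open>s\<close> is smooth, and pass to the closure by continuity.
  Then \<open>D\<^sub>0 u\<^sub>j = D\<^sub>j u\<^sub>0 = \<i> \<Sum> D\<^sub>j D\<^sub>k u\<^sub>k\<close>, and commuting \<open>D\<^sub>j\<close> past \<open>D\<^sub>k\<close> leaves
  \<open>\<i> \<Sum> D\<^sub>k D\<^sub>k u\<^sub>j\<close> plus the cubic curvature term. The divergence of the curvature identity with one
  time index gives the equation for \<open>a\<^sub>0\<close>, because \<open>Im (u\<^sub>k cnj u\<^sub>0)\<close> is minus the divergence of a stress
  tensor that is quadratic in \<open>u\<close>.

  The two-form is the analytic part. If spatially divergence-free potentials \<open>\<alpha>\<^sub>k\<close>
  satisfy \<open>\<Delta> \<alpha>\<^sub>k = a\<^sub>k\<close>, then \<open>\<kappa> = d \<alpha>\<close> is closed, its spatial divergence is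
  \<open>\<Delta> \<alpha>\<^sub>k - \<partial>\<^sub>k div \<alpha> = a\<^sub>k\<close>, and \<open>\<Delta> \<kappa> = d a\<close>, which is the curvature. Since \<open>a\<close> tends to \<open>0\<close>
  without a rate, the Newtonian potential of \<open>a\<^sub>k\<close> may diverge and has to be renormalised. Write
  \<open>A\<^sub>s f (t, x) = \<integral> p (y) f (t, x + s y) dy\<close> with \<open>p (y) = (1 - |y|\<^sup>2)\<^sub>+\<^sup>5\<close>, and \<open>B\<^sub>s\<close> for the same average
  with \<open>q (y) = 10 (1 - |y|\<^sup>2)\<^sub>+\<^sup>4\<close>. As \<open>\<nabla>p = - q y\<close>, one has \<open>d/ds B\<^sub>s f = s \<Delta> A\<^sub>s f\<close>, so that formally
  \<open>- \<integral>\<^sub>0\<^sup>\<infinity> s A\<^sub>s f ds\<close> solves \<open>\<Delta> \<alpha> = (\<integral>q) f\<close> if \<open>B\<^sub>s f\<close> tends to \<open>0\<close> at infinity, as it does for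
  \<open>f\<close> vanishing at infinity. The part \<open>s \<le> 1\<close> of the integral is harmless. The part \<open>s \<ge> 1\<close> may diverge, but its
  third spatial derivatives converge: each derivative falls on \<open>p\<close> and gains a factor \<open>1/s\<close>, so with
  \<open>r = 1/s\<close> they become \<open>- \<integral>\<^sub>0\<^sup>1 (\<integral> \<partial>\<^sub>i\<^sub>j\<^sub>k p (y) f (t, x + y/r) dy) dr\<close>, the integral over \<open>[0, 1]\<close> of a
  function that extends continuously by \<open>0\<close> to \<open>r = 0\<close> (\<open>continuous_far_avg\<close>). Three radial
  integrations from the origin, as in the Poincare lemma, then recover a potential, which amounts to
  subtracting the quadratic Taylor polynomial at \<open>x = 0\<close>. This renormalisation preserves vanishing of the
  divergence (\<open>div_tail_potential\<close>) and disturbs the Poisson equation only by a function of time alone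
  (\<open>lap_tail_potential\<close>), which a quadratic polynomial in \<open>x\<close> without divergence repairs
  (\<open>divergence_free_potential\<close>).
\<close>

section \<open>Partial derivatives on space-time\<close>

definition has_pd :: "('n::finite spacetime \<Rightarrow> 'b::real_normed_vector) \<Rightarrow> 'b \<Rightarrow> 'n option \<Rightarrow> 'n spacetime \<Rightarrow> bool" where
  "has_pd f d i z \<longleftrightarrow> ((\<lambda>h. f (z + h *\<^sub>R dir i)) has_vector_derivative d) (at 0)"

fun coord :: "'n::finite option \<Rightarrow> 'n spacetime \<Rightarrow> real" where
  "coord None z = fst z"
| "coord (Some j) z = snd z $ j"

lemma pd_eq: "has_pd f d i z \<Longrightarrow> pd i f z = d"
  unfolding has_pd_def pd_def by (rule vector_derivative_at)

lemma has_pd_differentiable: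
  assumes "f differentiable (at z)"
  shows "has_pd f (frechet_derivative f (at z) (dir i)) i z"
proof -
  have "(f has_derivative frechet_derivative f (at z)) (at (z + 0 *\<^sub>R dir i))"
    using assms by (simp add: frechet_derivative_works[symmetric])
  moreover have "((\<lambda>h. z + h *\<^sub>R dir i) has_derivative (\<lambda>h. h *\<^sub>R dir i)) (at 0)"
    by (auto intro!: derivative_eq_intros)
  ultimately have "((\<lambda>h. f (z + h *\<^sub>R dir i)) has_derivative
      (\<lambda>h. frechet_derivative f (at z) (h *\<^sub>R dir i))) (at 0)"
    by (metis has_derivative_compose)
  then show ?thesis
    unfolding has_pd_def has_vector_derivative_def
    by (simp add: linear_frechet_derivative[OF assms] linear_cmul)
qed

lemma has_pd_pd: "f differentiable (at z) \<Longrightarrow> has_pd f (pd i f z) i z"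
  using has_pd_differentiable pd_eq by metis

lemma has_pd_along_line:
  assumes "has_pd f d i (z + h *\<^sub>R dir i)"
  shows "((\<lambda>h. f (z + h *\<^sub>R dir i)) has_vector_derivative d) (at h)"
proof -
  have *: "((\<lambda>k. f (z + h *\<^sub>R dir i + k *\<^sub>R dir i)) has_vector_derivative d) (at (h - h))"
    using assms by (simp add: has_pd_def)
  have "((\<lambda>k. k - h) has_vector_derivative 1) (at h)"
    by (auto intro!: derivative_eq_intros)
  from vector_diff_chain_at[OF this *] show ?thesis
    by (simp add: o_def algebra_simps)
qed

text \<open>The vectors \<open>dir i\<close> and the functionals \<open>coord i\<close> are dual bases of space-time.\<close>

lemma coord_decomp: "(\<Sum>i\<in>UNIV. coord i v *\<^sub>R dir i) = v"
proof -
  have "(\<Sum>i\<in>UNIV. coord i v *\<^sub>R dir i) = fst v *\<^sub>R (1,0) + (\<Sum>j\<in>UNIV. (snd v $ j) *\<^sub>R (0, axis j 1))"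
    by (simp add: UNIV_option_conv sum.reindex)
  also have "\<dots> = v"
    by (simp add: prod_eq_iff fst_sum snd_sum vec_eq_iff axis_def if_distrib cong: if_cong)
  finally show ?thesis .
qed

lemma bounded_linear_coord: "bounded_linear (coord i)"
proof (cases i)
  case None
  then have "coord i = fst" by (simp add: fun_eq_iff)
  then show ?thesis by (simp add: bounded_linear_fst)
next
  case (Some j)
  then have "coord i = (\<lambda>v. snd v $ j)" by (simp add: fun_eq_iff)
  then show ?thesis by (simp add: bounded_linear_compose[OF bounded_linear_vec_nth bounded_linear_snd])
qed

lemma abs_coord_le: "\<bar>coord i v\<bar> \<le> norm v"
proof (cases i)
  case None then show ?thesis using norm_fst_le[of "fst v" "snd v"] by simp
next
  case (Some j) then show ?thesis using component_le_norm_cart[of "snd v" j] norm_snd_le[of "snd v" "fst v"]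
    by simp
qed

lemma norm_dir [simp]: "norm (dir i) = 1"
  by (cases i) (simp_all add: norm_Pair)

text \<open>The increment is split into steps along the coordinate axes, and the mean value theorem controls
  each step, because the partial derivatives vary little near \<open>z\<close>.\<close>

lemma C1_criterion:
  fixes f :: "'n::finite spacetime \<Rightarrow> 'b::real_normed_vector"
  assumes pds: "\<And>i z. has_pd f (g i z) i z" and cont: "\<And>i. continuous_on UNIV (g i)"
  shows "f differentiable (at z)"
proof -
  have bound: "\<exists>d>0. \<forall>v. norm v < d \<longrightarrow>
      norm (f (z + v) - f z - (\<Sum>i\<in>UNIV. coord i v *\<^sub>R g i z)) \<le> e * norm v" if "e > 0" for e
  proof -
    define m where "m = real (card (UNIV :: 'n option set))"
    have m: "m > 0" unfolding m_def by (simp add: card_gt_0_iff)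
    have "\<exists>d>0. \<forall>w. dist w z < d \<longrightarrow> norm (g i w - g i z) < e / m" for i
      using cont[of i] m \<open>e > 0\<close> unfolding continuous_on_iff dist_norm by (metis UNIV_I divide_pos_pos)
    then obtain D where D: "\<And>i. D i > 0" "\<And>i w. dist w z < D i \<Longrightarrow> norm (g i w - g i z) < e / m"
      by metis
    define d where "d = Min (range D)"
    have d: "d > 0" "\<And>i. d \<le> D i" unfolding d_def using D(1) by auto
    have step: "norm (f (z + (\<Sum>i\<in>I. c i *\<^sub>R dir i)) - f z - (\<Sum>i\<in>I. c i *\<^sub>R g i z))
        \<le> (\<Sum>i\<in>I. e / m * \<bar>c i\<bar>)" if "finite I" "(\<Sum>i\<in>I. \<bar>c i\<bar>) < d" for I c
      using that
    proof (induction I)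
      case empty then show ?case by simp
    next
      case (insert i I)
      define y where "y = z + (\<Sum>i\<in>I. c i *\<^sub>R dir i)"
      define S where "S = closed_segment 0 (c i)"
      have der: "((\<lambda>h. f (y + h *\<^sub>R dir i) - h *\<^sub>R g i z) has_derivative
          (\<lambda>k. k *\<^sub>R (g i (y + h *\<^sub>R dir i) - g i z))) (at h within S)" for h
      proof -
        have "((\<lambda>h. f (y + h *\<^sub>R dir i) - h *\<^sub>R g i z) has_vector_derivative
            (g i (y + h *\<^sub>R dir i) - g i z)) (at h)"
          by (rule derivative_eq_intros has_pd_along_line pds refl | simp)+
        then show ?thesis
          unfolding has_vector_derivative_def by (rule has_derivative_at_withinI)
      qed
      have near_potential: "dist (y + h *\<^sub>R dir i) z < D i" if "h \<in> S" for h
      proof -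
        have "norm (\<Sum>i\<in>I. c i *\<^sub>R dir i) \<le> (\<Sum>i\<in>I. \<bar>c i\<bar>)"
          by (rule order_trans[OF norm_sum]) simp
        moreover have "\<bar>h\<bar> \<le> \<bar>c i\<bar>" using that unfolding S_def
          by (auto simp: closed_segment_eq_real_ivl split: if_splits)
        moreover have "norm ((\<Sum>i\<in>I. c i *\<^sub>R dir i) + h *\<^sub>R dir i) \<le> norm (\<Sum>i\<in>I. c i *\<^sub>R dir i) + \<bar>h\<bar>"
          by (rule order_trans[OF norm_triangle_ineq]) simp
        ultimately have "norm ((\<Sum>i\<in>I. c i *\<^sub>R dir i) + h *\<^sub>R dir i) < d"
          using insert by simp
        then show ?thesis using d(2)[of i] by (simp add: dist_norm y_def)
      qed
      have "norm ((f (y + c i *\<^sub>R dir i) - c i *\<^sub>R g i z) - (f (y + 0 *\<^sub>R dir i) - 0 *\<^sub>R g i z))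
          \<le> e / m * norm (c i - 0)"
      proof (rule differentiable_bound[OF _ der])
        show "convex S" by (simp add: S_def)
        show "onorm (\<lambda>k. k *\<^sub>R (g i (y + h *\<^sub>R dir i) - g i z)) \<le> e / m" if "h \<in> S" for h
          using D(2)[OF near_potential[OF that]]
          by (intro onorm_le) (metis abs_ge_zero less_imp_le mult.commute mult_left_mono norm_scaleR real_norm_def)
      qed (auto simp: S_def)
      moreover have "norm (f y - f z - (\<Sum>i\<in>I. c i *\<^sub>R g i z)) \<le> (\<Sum>i\<in>I. e / m * \<bar>c i\<bar>)"
        unfolding y_def using insert by (intro insert.IH) auto
      ultimately have "norm (((f (y + c i *\<^sub>R dir i) - c i *\<^sub>R g i z) - (f (y + 0 *\<^sub>R dir i) - 0 *\<^sub>R g i z))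
           + (f y - f z - (\<Sum>i\<in>I. c i *\<^sub>R g i z))) \<le> e / m * \<bar>c i\<bar> + (\<Sum>i\<in>I. e / m * \<bar>c i\<bar>)"
        by (intro norm_triangle_le add_mono) auto
      moreover have "f (z + (\<Sum>i\<in>insert i I. c i *\<^sub>R dir i)) - f z - (\<Sum>i\<in>insert i I. c i *\<^sub>R g i z)
         = ((f (y + c i *\<^sub>R dir i) - c i *\<^sub>R g i z) - (f (y + 0 *\<^sub>R dir i) - 0 *\<^sub>R g i z))
           + (f y - f z - (\<Sum>i\<in>I. c i *\<^sub>R g i z))"
        using insert unfolding y_def by (simp add: algebra_simps)
      ultimately show ?case
        by (simp only: sum.insert[OF insert.hyps])
    qed
    show ?thesis
    proof (intro exI conjI allI impI)
      show "d / m > 0" using d m by simp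
      fix v :: "'n spacetime" assume v: "norm v < d / m"
      have le: "(\<Sum>i\<in>UNIV. \<bar>coord i v\<bar>) \<le> m * norm v"
        unfolding m_def by (rule sum_bounded_above) (rule abs_coord_le)
      also have "\<dots> < d" using v m by (simp add: field_simps)
      finally have "norm (f (z + v) - f z - (\<Sum>i\<in>UNIV. coord i v *\<^sub>R g i z))
          \<le> (\<Sum>i\<in>UNIV. e / m * \<bar>coord i v\<bar>)"
        using step[of UNIV "\<lambda>i. coord i v"] by (simp add: coord_decomp)
      also have "\<dots> = e / m * (\<Sum>i\<in>UNIV. \<bar>coord i v\<bar>)" by (simp add: sum_distrib_left)
      also have "\<dots> \<le> e / m * (m * norm v)" using le m \<open>e > 0\<close> by (intro mult_left_mono) auto
      finally show "norm (f (z + v) - f z - (\<Sum>i\<in>UNIV. coord i v *\<^sub>R g i z)) \<le> e * norm v"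
        using m by simp
    qed
  qed
  have "(f has_derivative (\<lambda>v. \<Sum>i\<in>UNIV. coord i v *\<^sub>R g i z)) (at z)"
    unfolding has_derivative_at_alt
  proof (intro conjI allI impI)
    show "bounded_linear (\<lambda>v. \<Sum>i\<in>UNIV. coord i v *\<^sub>R g i z)"
      by (intro bounded_linear_sum bounded_linear_scaleR_const bounded_linear_coord)
    fix e :: real assume "e > 0"
    from bound[OF this] obtain d where "d > 0" and d: "\<And>v. norm v < d \<Longrightarrow>
        norm (f (z + v) - f z - (\<Sum>i\<in>UNIV. coord i v *\<^sub>R g i z)) \<le> e * norm v" by metis
    show "\<exists>d>0. \<forall>y. norm (y - z) < d \<longrightarrow>
        norm (f y - f z - (\<Sum>i\<in>UNIV. coord i (y - z) *\<^sub>R g i z)) \<le> e * norm (y - z)"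
      using d[of "y - z" for y] \<open>d > 0\<close> by (intro exI[of _ d]) (simp add: algebra_simps)
  qed
  then show ?thesis unfolding differentiable_def by blast
qed

lemma Cm_continuous: "Cm_on m S f \<Longrightarrow> continuous_on S f"
  by (cases m) (auto simp: differentiable_imp_continuous_on)

text \<open>This reduces membership in \<open>C\<^sup>m\<close> to one-dimensional statements; all the smoothness proofs below go through it.\<close>

lemma Cm_SucI:
  assumes "\<And>i z. has_pd f (g i z) i z" and "\<And>i. Cm_on m UNIV (g i)"
  shows "Cm_on (Suc m) UNIV f"
proof -
  have "pd i f = g i" for i using pd_eq[OF assms(1)] by blast
  then show ?thesis
    using C1_criterion[OF assms(1) Cm_continuous[OF assms(2)]] assms(2) by (simp add: differentiable_on_def)
qed

lemma Cm_SucD: "Cm_on (Suc m) S f \<Longrightarrow> Cm_on m S f"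
proof (induction m arbitrary: f)
  case 0 then show ?case by (auto simp: differentiable_imp_continuous_on)
next
  case (Suc m) then show ?case by (metis Cm_on.simps(2))
qed

lemma Cm_mono: "Cm_on m S f \<Longrightarrow> k \<le> m \<Longrightarrow> Cm_on k S f"
proof (induction m)
  case (Suc m) then show ?case using Cm_SucD le_Suc_eq by blast
qed simp

lemma Cm_pd: "Cm_on (Suc m) S f \<Longrightarrow> Cm_on m S (pd i f)"
  by simp

lemma Cm_has_pd:
  assumes "Cm_on (Suc m) S f" "open S" "z \<in> S"
  shows "has_pd f (pd i f z) i z"
  using assms by (intro has_pd_pd) (auto simp: differentiable_on_eq_differentiable_at)

declare Cm_on.simps(2) [simp del]

lemma has_pd_const: "has_pd (\<lambda>z. c) 0 i z"
  by (simp add: has_pd_def)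

lemma has_pd_add: "has_pd f a i z \<Longrightarrow> has_pd g b i z \<Longrightarrow> has_pd (\<lambda>z. f z + g z) (a + b) i z"
  unfolding has_pd_def by (rule has_vector_derivative_add)

lemma has_pd_diff: "has_pd f a i z \<Longrightarrow> has_pd g b i z \<Longrightarrow> has_pd (\<lambda>z. f z - g z) (a - b) i z"
  unfolding has_pd_def by (rule has_vector_derivative_diff)

lemma has_pd_sum: "(\<And>k. k \<in> I \<Longrightarrow> has_pd (f k) (a k) i z) \<Longrightarrow> has_pd (\<lambda>z. \<Sum>k\<in>I. f k z) (\<Sum>k\<in>I. a k) i z"
  unfolding has_pd_def by (rule has_vector_derivative_sum)

lemma has_pd_mult:
  fixes f g :: "'n::finite spacetime \<Rightarrow> 'b::real_normed_algebra"
  shows "has_pd f a i z \<Longrightarrow> has_pd g b i z \<Longrightarrow> has_pd (\<lambda>z. f z * g z) (f z * b + a * g z) i z"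
  unfolding has_pd_def by (drule (1) has_vector_derivative_mult) simp

lemma has_pd_linear: "bounded_linear L \<Longrightarrow> has_pd f a i z \<Longrightarrow> has_pd (\<lambda>z. L (f z)) (L a) i z"
  unfolding has_pd_def by (rule bounded_linear.has_vector_derivative)

lemmas has_pd_of_real = has_pd_linear[OF bounded_linear_of_real]
lemmas has_pd_cnj = has_pd_linear[OF bounded_linear_cnj]
lemmas has_pd_Re = has_pd_linear[OF bounded_linear_Re]
lemmas has_pd_cmult = has_pd_linear[OF bounded_linear_mult_right]

lemma has_pd_chain:
  fixes f :: "'n::finite spacetime \<Rightarrow> 'b::real_normed_field"
  assumes "(G has_field_derivative D) (at (f z))" and "has_pd f a i z"
  shows "has_pd (\<lambda>z. G (f z)) (D * a) i z"
proof -
  have "(G has_field_derivative D) (at (f (z + 0 *\<^sub>R dir i)))" using assms by simp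
  with assms(2) show ?thesis
    unfolding has_pd_def using field_vector_diff_chain_at[of "\<lambda>h. f (z + h *\<^sub>R dir i)" a 0 G D]
    by (simp add: o_def mult.commute)
qed

lemma has_pd_coord: "has_pd (coord k) (if k = i then 1 else 0) i z"
proof -
  have "coord k (z + h *\<^sub>R dir i) = coord k z + h * (if k = i then 1 else 0)" for h
    by (cases k; cases i) (auto simp: axis_def)
  then show ?thesis unfolding has_pd_def by (auto intro!: derivative_eq_intros)
qed

lemma has_pd_cong_open:
  assumes "has_pd f a i z" "open S" "z \<in> S" "\<And>y. y \<in> S \<Longrightarrow> f y = g y"
  shows "has_pd g a i z"
proof -
  have "open ((\<lambda>h. z + h *\<^sub>R dir i) -` S)"
    by (intro open_vimage assms(2) continuous_intros)
  show ?thesis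
    unfolding has_pd_def
    by (rule has_vector_derivative_transform_within_open[OF assms(1)[unfolded has_pd_def]
          \<open>open ((\<lambda>h. z + h *\<^sub>R dir i) -` S)\<close>]) (use assms(3,4) in auto)
qed

subsection \<open>Closure properties\<close>

lemma Cm_numeral:
  "Cm_on 4 S f \<Longrightarrow> Cm_on 3 S f" "Cm_on 3 S f \<Longrightarrow> Cm_on 2 S f" "Cm_on 2 S f \<Longrightarrow> Cm_on 1 S f"
  "Cm_on 4 S f \<Longrightarrow> Cm_on 3 S (pd i f)" "Cm_on 3 S f \<Longrightarrow> Cm_on 2 S (pd i f)" "Cm_on 2 S f \<Longrightarrow> Cm_on 1 S (pd i f)"
  using Cm_SucD[of _ S f] Cm_pd[of _ S f] by (simp_all add: eval_nat_numeral)

lemma Cm_has_pd_UNIV: "Cm_on (Suc m) UNIV f \<Longrightarrow> has_pd f (pd i f z) i z"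
  using Cm_has_pd open_UNIV by blast

lemma Cm_const: "Cm_on m UNIV (\<lambda>z. c)"
proof (induction m arbitrary: c)
  case (Suc m) show ?case by (rule Cm_SucI[where g = "\<lambda>i z. 0"]; intro has_pd_const Suc)
qed auto

lemma Cm_add: "Cm_on m UNIV f \<Longrightarrow> Cm_on m UNIV g \<Longrightarrow> Cm_on m UNIV (\<lambda>z. f z + g z)"
proof (induction m arbitrary: f g)
  case 0 then show ?case by (simp add: continuous_on_add continuous_on_mult)
next
  case (Suc m)
  show ?case
    by (rule Cm_SucI[where g = "\<lambda>i z. pd i f z + pd i g z"];
        intro has_pd_add Cm_has_pd_UNIV[OF Suc.prems(1)] Cm_has_pd_UNIV[OF Suc.prems(2)] Suc.IH Cm_pd[OF Suc.prems(1)] Cm_pd[OF Suc.prems(2)])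
qed

lemma Cm_linear: "bounded_linear L \<Longrightarrow> Cm_on m UNIV f \<Longrightarrow> Cm_on m UNIV (\<lambda>z. L (f z))"
proof (induction m arbitrary: f)
  case 0 then show ?case by (auto intro: bounded_linear.continuous_on)
next
  case (Suc m)
  show ?case
    by (rule Cm_SucI[where g = "\<lambda>i z. L (pd i f z)"];
        intro has_pd_linear[OF Suc.prems(1)] Suc.prems(1) Cm_has_pd_UNIV[OF Suc.prems(2)] Suc.IH Cm_pd[OF Suc.prems(2)])
qed

lemma Cm_mult:
  fixes f g :: "'n::finite spacetime \<Rightarrow> 'b::real_normed_algebra"
  shows "Cm_on m UNIV f \<Longrightarrow> Cm_on m UNIV g \<Longrightarrow> Cm_on m UNIV (\<lambda>z. f z * g z)"
proof (induction m arbitrary: f g)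
  case 0 then show ?case by (simp add: continuous_on_add continuous_on_mult)
next
  case (Suc m)
  show ?case
    by (rule Cm_SucI[where g = "\<lambda>i z. f z * pd i g z + pd i f z * g z"];
        intro has_pd_mult Cm_add Cm_SucD[OF Suc.prems(1)] Cm_SucD[OF Suc.prems(2)]
        Cm_has_pd_UNIV[OF Suc.prems(1)] Cm_has_pd_UNIV[OF Suc.prems(2)] Suc.IH Cm_pd[OF Suc.prems(1)] Cm_pd[OF Suc.prems(2)])
qed

lemma Cm_sum:
  assumes "\<And>k. k \<in> I \<Longrightarrow> Cm_on m UNIV (f k)"
  shows "Cm_on m UNIV (\<lambda>z. \<Sum>k\<in>I. f k z)"
  using assms by (induction I rule: infinite_finite_induct) (auto simp: Cm_const Cm_add)

lemma Cm_cmult: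
  fixes f :: "'n::finite spacetime \<Rightarrow> 'b::real_normed_algebra"
  shows "Cm_on m UNIV f \<Longrightarrow> Cm_on m UNIV (\<lambda>z. c * f z)"
  by (rule Cm_mult[OF Cm_const])

lemma Cm_diff:
  fixes f g :: "'n::finite spacetime \<Rightarrow> 'b::real_normed_vector"
  shows "Cm_on m UNIV f \<Longrightarrow> Cm_on m UNIV g \<Longrightarrow> Cm_on m UNIV (\<lambda>z. f z - g z)"
  using Cm_add[OF _ Cm_linear[OF bounded_linear_minus[OF bounded_linear_ident]], of m f g] by simp

lemma Cm_coord: "Cm_on m UNIV (coord k)"
proof (cases m)
  case 0 then show ?thesis by (simp add: linear_continuous_on bounded_linear_coord)
next
  case (Suc m')
  have "Cm_on (Suc m') UNIV (coord k)"
    by (rule Cm_SucI[where g = "\<lambda>i z. if k = i then 1 else 0"]; rule has_pd_coord Cm_const)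
  with Suc show ?thesis by simp
qed

subsection \<open>Mixed partial derivatives commute\<close>

text \<open>The classes \<open>C\<^sup>m\<close> speak of iterated partial derivatives, so the symmetry is obtained from one-variable
  calculus: differentiate \<open>f (x, y) - f (-r, y) = \<integral> \<partial>\<^sub>i f\<close> under the integral in the direction \<open>j\<close>, then
  differentiate the result in the upper limit.\<close>

lemma pd_commute:
  fixes f :: "'n::finite spacetime \<Rightarrow> 'b::banach"
  assumes f: "Cm_on 2 S f" and S: "open S" "z \<in> S"
  shows "pd i (pd j f) z = pd j (pd i f) z"
proof -
  obtain e where e: "e > 0" "ball z e \<subseteq> S" using S openE by blast
  define r where "r = e / 3"
  have r: "r > 0" using e by (simp add: r_def)
  have nb: "at 0 within {-r..r} \<noteq> bot" using r by (simp add: at_within_Icc_at)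
  define w where "w x y = z + x *\<^sub>R dir i + y *\<^sub>R dir j" for x y
  have w: "w x y \<in> S" if "x \<in> {-r..r}" "y \<in> {-r..r}" for x y
  proof -
    have "norm (x *\<^sub>R dir i + y *\<^sub>R dir j) \<le> \<bar>x\<bar> + \<bar>y\<bar>"
      by (rule order_trans[OF norm_triangle_ineq]) simp
    also have "\<dots> < e" using that e by (auto simp: r_def)
    finally have "dist (w x y) z < e" unfolding w_def by (simp add: dist_norm add.assoc)
    then have "w x y \<in> ball z e" by (simp add: dist_commute)
    then show ?thesis using e by blast
  qed
  have f1: "Cm_on (Suc 1) S f" and f0: "Cm_on (Suc 0) S f" "Cm_on (Suc 0) S (pd k f)" for k
    using f Cm_mono[OF f] by (simp_all add: numeral_2_eq_2 Cm_on.simps(2) differentiable_imp_continuous_on)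
  have wx: "((\<lambda>x. g (w x y)) has_vector_derivative pd i g (w x y)) (at x within T)"
    if "Cm_on (Suc 0) S g" "x \<in> {-r..r}" "y \<in> {-r..r}" for g :: "'n spacetime \<Rightarrow> 'b" and x y T
    using has_pd_along_line[of g "pd i g (w x y)" i "z + y *\<^sub>R dir j" x] Cm_has_pd[OF that(1) S(1) w[OF that(2,3)]]
    by (simp add: w_def algebra_simps has_vector_derivative_at_within)
  have wy: "((\<lambda>y. g (w x y)) has_vector_derivative pd j g (w x y)) (at y within T)"
    if "Cm_on (Suc 0) S g" "x \<in> {-r..r}" "y \<in> {-r..r}" for g :: "'n spacetime \<Rightarrow> 'b" and x y T
    using has_pd_along_line[of g "pd j g (w x y)" j "z + x *\<^sub>R dir i" y] Cm_has_pd[OF that(1) S(1) w[OF that(2,3)]]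
    by (simp add: w_def algebra_simps has_vector_derivative_at_within)
  have cont2: "continuous_on S (pd j (pd i f))" using f by (simp add: numeral_2_eq_2 Cm_on.simps(2))
  have cont1: "continuous_on S (pd i f)" using f0(2) Cm_continuous by blast
  have G: "pd j f (w x 0) = pd j f (w (-r) 0) + integral {-r..x} (\<lambda>\<xi>. pd j (pd i f) (w \<xi> 0))"
    if x: "x \<in> {-r..r}" for x
  proof -
    have FTC: "f (w x y) - f (w (-r) y) = integral {-r..x} (\<lambda>\<xi>. pd i f (w \<xi> y))" if "y \<in> {-r..r}" for y
      using that x r
      by (intro integral_unique[symmetric] fundamental_theorem_of_calculus wx f0) auto
    have 1: "((\<lambda>y. f (w x y) - f (w (-r) y)) has_vector_derivative (pd j f (w x 0) - pd j f (w (-r) 0)))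
        (at 0 within {-r..r})"
      using x r by (intro has_vector_derivative_diff wy f0) auto
    have 2: "((\<lambda>y. integral (cbox (-r) x) (\<lambda>\<xi>. pd i f (w \<xi> y))) has_vector_derivative
        integral (cbox (-r) x) (\<lambda>\<xi>. pd j (pd i f) (w \<xi> 0))) (at 0 within {-r..r})"
    proof (rule leibniz_rule_vector_derivative)
      show "((\<lambda>y. pd i f (w \<xi> y)) has_vector_derivative pd j (pd i f) (w \<xi> y)) (at y within {-r..r})"
        if "y \<in> {-r..r}" "\<xi> \<in> cbox (-r) x" for y \<xi>
        using that x by (intro wy f0) auto
      show "(\<lambda>\<xi>. pd i f (w \<xi> y)) integrable_on cbox (-r) x" if "y \<in> {-r..r}" for y
        using that x w by (intro integrable_continuous continuous_on_compose2[OF cont1])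
          (auto simp: w_def intro!: continuous_intros)
      show "continuous_on ({-r..r} \<times> cbox (-r) x) (\<lambda>(y, \<xi>). pd j (pd i f) (w \<xi> y))"
        using x w unfolding split_beta
        by (intro continuous_on_compose2[OF cont2]) (auto simp: w_def intro!: continuous_intros)
    qed (use r in auto)
    have "((\<lambda>y. f (w x y) - f (w (-r) y)) has_vector_derivative
        integral (cbox (-r) x) (\<lambda>\<xi>. pd j (pd i f) (w \<xi> 0))) (at 0 within {-r..r})"
      by (rule has_vector_derivative_transform[OF _ _ 2]) (use r FTC in auto)
    from vector_derivative_unique_within[OF nb 1 this] show ?thesis
      by (simp add: algebra_simps)
  qed
  have "continuous_on {-r..r} (\<lambda>\<xi>. pd j (pd i f) (w \<xi> 0))"
  proof (rule continuous_on_compose2[OF cont2])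
    show "continuous_on {-r..r} (\<lambda>\<xi>. w \<xi> 0)" unfolding w_def by (intro continuous_intros)
    show "(\<lambda>\<xi>. w \<xi> 0) ` {-r..r} \<subseteq> S" using w[of _ 0] r by auto
  qed
  then have "((\<lambda>x. integral {-r..x} (\<lambda>\<xi>. pd j (pd i f) (w \<xi> 0))) has_vector_derivative
      pd j (pd i f) (w 0 0)) (at 0 within {-r..r})"
    by (rule integral_has_vector_derivative) (use r in simp)
  from has_vector_derivative_add[OF has_vector_derivative_const this, of "pd j f (w (-r) 0)"]
  have "((\<lambda>x. pd j f (w (-r) 0) + integral {-r..x} (\<lambda>\<xi>. pd j (pd i f) (w \<xi> 0))) has_vector_derivative
      pd j (pd i f) (w 0 0)) (at 0 within {-r..r})"
    by simp
  then have 1: "((\<lambda>x. pd j f (w x 0)) has_vector_derivative pd j (pd i f) (w 0 0)) (at 0 within {-r..r})"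
    by (rule has_vector_derivative_transform[rotated 2]) (use r in simp, rule G)
  have 2: "((\<lambda>x. pd j f (w x 0)) has_vector_derivative pd i (pd j f) (w 0 0)) (at 0 within {-r..r})"
    using r by (intro wx f0) auto
  from vector_derivative_unique_within[OF nb 1 2] show ?thesis
    by (simp add: w_def)
qed

subsection \<open>Integrals depending on a parameter\<close>

lemma has_pd_integral:
  fixes g :: "'p::euclidean_space \<Rightarrow> 'n::finite spacetime \<Rightarrow> 'b::banach"
  assumes der: "\<And>\<theta> z. \<theta> \<in> cbox a b \<Longrightarrow> has_pd (g \<theta>) (g' \<theta> z) i z"
    and cont: "continuous_on (cbox a b \<times> UNIV) (\<lambda>(\<theta>, z). g' \<theta> z)"
    and int: "\<And>z. (\<lambda>\<theta>. g \<theta> z) integrable_on cbox a b"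
  shows "has_pd (\<lambda>z. integral (cbox a b) (\<lambda>\<theta>. g \<theta> z)) (integral (cbox a b) (\<lambda>\<theta>. g' \<theta> z)) i z"
proof -
  have "((\<lambda>h. integral (cbox a b) (\<lambda>\<theta>. g \<theta> (z + h *\<^sub>R dir i))) has_vector_derivative
      integral (cbox a b) (\<lambda>\<theta>. g' \<theta> (z + 0 *\<^sub>R dir i))) (at 0 within UNIV)"
  proof (rule leibniz_rule_vector_derivative)
    show "((\<lambda>h. g \<theta> (z + h *\<^sub>R dir i)) has_vector_derivative g' \<theta> (z + h *\<^sub>R dir i)) (at h within UNIV)"
      if "\<theta> \<in> cbox a b" for h \<theta>
      using has_pd_along_line der[OF that] by blast
    show "continuous_on (UNIV \<times> cbox a b) (\<lambda>(h, \<theta>). g' \<theta> (z + h *\<^sub>R dir i))"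
    proof -
      have "continuous_on (UNIV \<times> cbox a b) (\<lambda>x. (\<lambda>(\<theta>, z). g' \<theta> z) (snd x, z + fst x *\<^sub>R dir i))"
        by (rule continuous_on_compose2[OF cont]) (auto intro!: continuous_intros)
      then show ?thesis by (simp add: split_beta)
    qed
  qed (use int in auto)
  then show ?thesis by (simp add: has_pd_def)
qed

lemma continuous_on_integral_param:
  fixes g :: "'p::euclidean_space \<Rightarrow> 'a::topological_space \<Rightarrow> 'b::banach"
  assumes "continuous_on (cbox a b \<times> S) (\<lambda>(\<theta>, z). g \<theta> z)"
  shows "continuous_on S (\<lambda>z. integral (cbox a b) (\<lambda>\<theta>. g \<theta> z))"
proof (rule integral_continuous_on_param)
  show "continuous_on (S \<times> cbox a b) (\<lambda>(z, \<theta>). g \<theta> z)"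
  proof -
    have "continuous_on (S \<times> cbox a b) (\<lambda>x. (\<lambda>(\<theta>, z). g \<theta> z) (snd x, fst x))"
      by (rule continuous_on_compose2[OF assms]) (auto intro!: continuous_intros)
    then show ?thesis by (simp add: split_beta)
  qed
qed

lemma integrable_param:
  fixes g :: "'p::euclidean_space \<Rightarrow> 'a::topological_space \<Rightarrow> 'b::banach"
  assumes "continuous_on (cbox a b \<times> S) (\<lambda>(\<theta>, z). g \<theta> z)" "z \<in> S"
  shows "(\<lambda>\<theta>. g \<theta> z) integrable_on cbox a b"
proof (rule integrable_continuous)
  have "continuous_on (cbox a b) (\<lambda>\<theta>. (\<lambda>(\<theta>, z). g \<theta> z) (\<theta>, z))"
    by (rule continuous_on_compose2[OF assms(1)]) (auto intro!: continuous_intros assms(2))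
  then show "continuous_on (cbox a b) (\<lambda>\<theta>. g \<theta> z)" by simp
qed

section \<open>Averages against a compactly supported kernel\<close>

text \<open>The kernels below live on the unit ball. The larger box leaves room for shifting them by
  vectors of length at most \<open>1\<close>.\<close>

abbreviation Qbox :: "(real ^ 'n::finite) set" where
  "Qbox \<equiv> cbox (vec (-2)) (vec 2)"

text \<open>Kernels are functions of the space variable. They are encoded as time-independent functions on
  space-time so that \<open>Cm_on\<close> and \<open>pd\<close> apply to them.\<close>

definition space_kernel :: "nat \<Rightarrow> ('n::finite spacetime \<Rightarrow> real) \<Rightarrow> bool" where
  "space_kernel m \<phi> \<longleftrightarrow> Cm_on m UNIV \<phi> \<and> (\<forall>t y. \<phi> (t, y) = \<phi> (0, y)) \<and> (\<forall>t y. 1 < norm y \<longrightarrow> \<phi> (t, y) = 0)"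

definition avg :: "('n::finite spacetime \<Rightarrow> real) \<Rightarrow> real \<Rightarrow> ('n spacetime \<Rightarrow> real) \<Rightarrow> 'n spacetime \<Rightarrow> real" where
  "avg \<phi> s f z = integral Qbox (\<lambda>y. \<phi> (0, y) * f (z + (0, s *\<^sub>R y)))"

lemma kernel_continuous: "space_kernel m \<phi> \<Longrightarrow> continuous_on UNIV \<phi>"
  unfolding space_kernel_def using Cm_continuous by blast

lemma kernel_SucD: "space_kernel (Suc m) \<phi> \<Longrightarrow> space_kernel m \<phi>"
  unfolding space_kernel_def using Cm_SucD by blast

lemma kernel_time: "space_kernel m \<phi> \<Longrightarrow> \<phi> (t, y) = \<phi> (0, y)"
  unfolding space_kernel_def by blast

lemma kernel_outside: "space_kernel m \<phi> \<Longrightarrow> 1 < norm y \<Longrightarrow> \<phi> (t, y) = 0"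
  unfolding space_kernel_def by blast

lemma kernel_pd:
  assumes "space_kernel (Suc m) \<phi>"
  shows "space_kernel m (pd i \<phi>)"
  unfolding space_kernel_def
proof (intro conjI allI impI)
  show "Cm_on m UNIV (pd i \<phi>)" using assms unfolding space_kernel_def by (simp add: Cm_pd)
next
  fix t y
  have "\<phi> ((t, y) + h *\<^sub>R dir i) = \<phi> ((0, y) + h *\<^sub>R dir i)" for h
  proof (cases i)
    case None
    then show ?thesis using kernel_time[OF assms, of "t + h" y] kernel_time[OF assms, of h y] by simp
  next
    case (Some l)
    then show ?thesis using kernel_time[OF assms, of t] by simp
  qed
  then show "pd i \<phi> (t, y) = pd i \<phi> (0, y)" by (simp only: pd_def)
next
  fix t :: real and y :: "real ^ 'a" assume y: "1 < norm y"
  have "has_pd \<phi> 0 i (t, y)"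
  proof (rule has_pd_cong_open[OF has_pd_const])
    have "open ((\<lambda>z :: 'a spacetime. norm (snd z)) -` {1<..})"
      by (intro open_vimage continuous_intros)
    then show "open {z :: 'a spacetime. 1 < norm (snd z)}"
      by (simp add: vimage_def)
  qed (use y kernel_outside[OF assms] in auto)
  then show "pd i \<phi> (t, y) = 0" by (rule pd_eq)
qed

lemma continuous_avg_integrand:
  fixes \<phi> f :: "'n::finite spacetime \<Rightarrow> real"
  assumes "continuous_on UNIV \<phi>" "continuous_on UNIV f"
  shows "continuous_on (S \<times> T) (\<lambda>(y, z). \<phi> (0::real, y) * f (z + (0, s *\<^sub>R y)))"
  unfolding split_beta
  by (intro continuous_intros continuous_on_compose2[OF assms(1)] continuous_on_compose2[OF assms(2)]) auto

lemma has_pd_shift: "has_pd f d i (z + v) \<Longrightarrow> has_pd (\<lambda>z. f (z + v)) d i z"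
  by (simp add: has_pd_def add.assoc add.commute[of v])

lemma avg_integrable:
  fixes \<phi> f :: "'n::finite spacetime \<Rightarrow> real"
  assumes "continuous_on UNIV \<phi>" "continuous_on UNIV f"
  shows "(\<lambda>y. \<phi> (0, y) * f (z + (0, s *\<^sub>R y))) integrable_on cbox a b"
  by (rule integrable_param[OF continuous_avg_integrand[OF assms, of _ UNIV]]) simp

lemma has_pd_avg:
  assumes "continuous_on UNIV \<phi>" "Cm_on 1 UNIV f"
  shows "has_pd (avg \<phi> s f) (avg \<phi> s (pd i f) z) i z"
proof -
  have f: "Cm_on (Suc 0) UNIV f" using assms by simp
  show ?thesis
    unfolding avg_def[abs_def]
    by (rule has_pd_integral has_pd_cmult has_pd_shift Cm_has_pd_UNIV[OF f] continuous_avg_integrand avg_integrable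
        assms(1) Cm_continuous[OF f] Cm_continuous[OF Cm_pd[OF f]])+
qed

lemma continuous_avg:
  fixes \<phi> f :: "'n::finite spacetime \<Rightarrow> real"
  assumes "continuous_on UNIV \<phi>" "continuous_on UNIV f"
  shows "continuous_on S (\<lambda>(s, z). avg \<phi> s f z)"
proof -
  have "continuous_on S (\<lambda>x. integral Qbox (\<lambda>y. \<phi> (0, y) * f (snd x + (0, fst x *\<^sub>R y))))"
    by (rule continuous_on_integral_param, unfold split_beta)
     (intro continuous_intros continuous_on_compose2[OF assms(1)] continuous_on_compose2[OF assms(2)]; simp)
  then show ?thesis by (simp add: avg_def split_beta)
qed

lemma ball_in_Qbox:
  assumes "norm y \<le> 2" shows "y \<in> Qbox"
proof -
  have "\<bar>y $ i\<bar> \<le> 2" for i using component_le_norm_cart[of y i] assms by linarith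
  then show ?thesis unfolding mem_box_cart by (simp add: abs_le_iff minus_le_iff)
qed

text \<open>A shift of the function is a shift of the kernel, so for a smooth kernel the averages of a
  merely continuous function are differentiable in space.\<close>

lemma avg_shift:
  assumes \<phi>: "space_kernel m \<phi>" and h: "\<bar>h\<bar> \<le> 1"
  shows "avg \<phi> s f (z + (s * h) *\<^sub>R dir (Some l))
    = integral Qbox (\<lambda>y. \<phi> ((0, y) + (- h) *\<^sub>R dir (Some l)) * f (z + (0, s *\<^sub>R y)))"
proof -
  define c :: "real ^ 'a" where "c = h *\<^sub>R axis l 1"
  have c: "norm c \<le> 1" using h by (simp add: c_def)
  define G where "G y = \<phi> (0, y - c) * f (z + (0, s *\<^sub>R y))" for y
  have G0: "G y = 0" if "y \<notin> Qbox \<or> y \<notin> cbox (vec (-2) + c) (vec 2 + c)" for y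
  proof -
    have "1 < norm (y - c)"
    proof (rule ccontr)
      assume "\<not> ?thesis"
      then have 1: "norm (y - c) \<le> 1" by simp
      then have "norm y \<le> 2" using c norm_triangle_sub[of y c] by simp
      then have "y \<in> Qbox" "y - c \<in> Qbox" using 1 by (auto intro!: ball_in_Qbox)
      moreover have "y \<in> cbox (vec (-2) + c) (vec 2 + c)"
        using \<open>y - c \<in> Qbox\<close> unfolding mem_box_cart by (simp add: algebra_simps)
      ultimately show False using that by blast
    qed
    then show ?thesis using kernel_outside[OF \<phi>] by (simp add: G_def)
  qed
  have "avg \<phi> s f (z + (s * h) *\<^sub>R dir (Some l)) = integral Qbox (G \<circ> (+) c)"
    by (simp add: avg_def G_def o_def c_def algebra_simps)
  also have "\<dots> = integral (cbox (vec (-2) + c) (vec 2 + c)) G"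
    by (rule integral_shift_cbox_plus)
  also have "\<dots> = integral UNIV (\<lambda>y. if y \<in> cbox (vec (-2) + c) (vec 2 + c) then G y else 0)"
    by (rule integral_restrict_UNIV[symmetric])
  also have "(\<lambda>y. if y \<in> cbox (vec (-2) + c) (vec 2 + c) then G y else 0) = (\<lambda>y. if y \<in> Qbox then G y else 0)"
    using G0 by fastforce
  also have "integral UNIV \<dots> = integral Qbox G"
    by (rule integral_restrict_UNIV)
  finally show ?thesis by (simp add: G_def[abs_def] c_def)
qed

text \<open>Here \<open>f\<close> is only continuous: by the previous lemma the derivative can be put on the kernel,
  where it comes with a factor \<open>- 1 / s\<close>. This gain is what makes the integral over large scales converge after three
  derivatives.\<close>

lemma has_pd_avg_kernel:
  assumes \<phi>: "space_kernel (Suc m) \<phi>" and f: "continuous_on UNIV f" and s: "s > 0"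
  shows "has_pd (avg \<phi> s f) (- (1 / s) * avg (pd (Some l) \<phi>) s f z) (Some l) z"
proof -
  define W where "W h = integral Qbox (\<lambda>y. \<phi> ((0, y) + h *\<^sub>R dir (Some l)) * f (z + (0, s *\<^sub>R y)))" for h
  have C: "Cm_on (Suc m) UNIV \<phi>" using \<phi> by (simp add: space_kernel_def)
  note cont = Cm_continuous[OF C] Cm_continuous[OF Cm_pd[OF C]]
  have "(W has_vector_derivative integral Qbox (\<lambda>y. pd (Some l) \<phi> ((0, y) + 0 *\<^sub>R dir (Some l)) * f (z + (0, s *\<^sub>R y))))
      (at 0 within UNIV)"
    unfolding W_def
  proof (rule leibniz_rule_vector_derivative[where fx = "\<lambda>h y. pd (Some l) \<phi> ((0, y) + h *\<^sub>R dir (Some l)) * f (z + (0, s *\<^sub>R y))"])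
    show "((\<lambda>h. \<phi> ((0, y) + h *\<^sub>R dir (Some l)) * f (z + (0, s *\<^sub>R y))) has_vector_derivative
        pd (Some l) \<phi> ((0, y) + h *\<^sub>R dir (Some l)) * f (z + (0, s *\<^sub>R y))) (at h within UNIV)" for h y
      by (rule has_vector_derivative_mult_left[OF has_pd_along_line[OF Cm_has_pd_UNIV[OF C]]])
    show "(\<lambda>y. \<phi> ((0, y) + h *\<^sub>R dir (Some l)) * f (z + (0, s *\<^sub>R y))) integrable_on Qbox" for h
      by (intro integrable_continuous continuous_intros continuous_on_compose2[OF f]
        continuous_on_compose2[OF cont(1)]) simp_all
    show "continuous_on (UNIV \<times> Qbox) (\<lambda>(h, y). pd (Some l) \<phi> ((0, y) + h *\<^sub>R dir (Some l)) * f (z + (0, s *\<^sub>R y)))"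
      unfolding split_beta by (intro continuous_intros continuous_on_compose2[OF f]
        continuous_on_compose2[OF cont(2)]) simp_all
  qed simp_all
  then have W: "(W has_vector_derivative avg (pd (Some l) \<phi>) s f z) (at (- (1 / s) * 0))"
    by (simp add: avg_def)
  have "((\<lambda>h. - (1 / s) * h) has_vector_derivative - (1 / s)) (at 0)"
    by (auto intro!: derivative_eq_intros)
  from vector_diff_chain_at[OF this W]
  have 1: "((\<lambda>h. W (- (1 / s) * h)) has_vector_derivative - (1 / s) * avg (pd (Some l) \<phi>) s f z) (at 0)"
    by (simp add: o_def)
  show ?thesis unfolding has_pd_def
  proof (rule has_vector_derivative_transform_within_open[OF 1])
    show "open {-s<..<s}" "0 \<in> {-s<..<s}" using s by auto
    fix h assume "h \<in> {-s<..<s}"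
    then have "\<bar>h / s\<bar> \<le> 1" using s by (simp add: abs_le_iff)
    from avg_shift[OF \<phi> this, of s f z l] s
    show "W (- (1 / s) * h) = avg \<phi> s f (z + h *\<^sub>R dir (Some l))" by (simp add: W_def)
  qed
qed

text \<open>Both ways of differentiating the average of a \<open>C\<^sup>1\<close> function must agree.\<close>

lemma avg_by_parts:
  assumes "space_kernel (Suc m) \<phi>" "Cm_on 1 UNIV f" "s > 0"
  shows "avg (pd (Some l) \<phi>) s f z = - s * avg \<phi> s (pd (Some l) f) z"
proof -
  have "- (1 / s) * avg (pd (Some l) \<phi>) s f z = avg \<phi> s (pd (Some l) f) z"
    using pd_eq[OF has_pd_avg_kernel[OF assms(1) Cm_continuous[OF assms(2)] assms(3), of l z]]
      pd_eq[OF has_pd_avg[OF kernel_continuous[OF assms(1)] assms(2), of s "Some l" z]] by simp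
  then show ?thesis using assms(3) by (simp add: field_simps)
qed

lemma has_derivative_pd:
  fixes f :: "'n::finite spacetime \<Rightarrow> 'b::real_normed_vector"
  assumes "f differentiable (at z)"
  shows "(f has_derivative (\<lambda>v. \<Sum>i\<in>UNIV. coord i v *\<^sub>R pd i f z)) (at z)"
proof -
  let ?D = "frechet_derivative f (at z)"
  have D: "(f has_derivative ?D) (at z)" using assms by (simp add: frechet_derivative_works[symmetric])
  have "?D v = (\<Sum>i\<in>UNIV. coord i v *\<^sub>R pd i f z)" for v
  proof -
    have "?D v = ?D (\<Sum>i\<in>UNIV. coord i v *\<^sub>R dir i)" by (simp add: coord_decomp)
    also have "\<dots> = (\<Sum>i\<in>UNIV. coord i v *\<^sub>R ?D (dir i))"
      using linear_frechet_derivative[OF assms] by (simp add: linear_sum linear_cmul o_def)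
    finally show ?thesis using pd_eq[OF has_pd_differentiable[OF assms]] by simp
  qed
  then have "?D = (\<lambda>v. \<Sum>i\<in>UNIV. coord i v *\<^sub>R pd i f z)" by blast
  with D show ?thesis by simp
qed

lemma chain_along_space_ray:
  assumes "Cm_on 1 UNIV f"
  shows "((\<lambda>s. f (z + (0, s *\<^sub>R y))) has_vector_derivative
    (\<Sum>l\<in>UNIV. (y $ l) *\<^sub>R pd (Some l) f (z + (0, s *\<^sub>R y)))) (at s within T)"
proof -
  have "f differentiable (at (z + (0, s *\<^sub>R y)))"
    using assms by (simp add: One_nat_def Cm_on.simps(2) differentiable_on_def del: split_paired_All)
  note D = has_derivative_pd[OF this]
  have "((\<lambda>s. z + (0::real, s *\<^sub>R y)) has_derivative (\<lambda>h. (0, h *\<^sub>R y))) (at s within T)"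
    by (rule derivative_eq_intros refl | simp add: zero_prod_def)+
  from has_derivative_compose[OF this D]
  have "((\<lambda>s. f (z + (0, s *\<^sub>R y))) has_derivative
     (\<lambda>h. \<Sum>i\<in>UNIV. coord i (0, h *\<^sub>R y) *\<^sub>R pd i f (z + (0, s *\<^sub>R y)))) (at s within T)" .
  moreover have "(\<Sum>i\<in>UNIV. coord i (0, h *\<^sub>R y) *\<^sub>R pd i f (z + (0, s *\<^sub>R y)))
      = h *\<^sub>R (\<Sum>l\<in>UNIV. (y $ l) *\<^sub>R pd (Some l) f (z + (0, s *\<^sub>R y)))" for h
    by (simp add: UNIV_option_conv sum.reindex scaleR_sum_right)
  ultimately show ?thesis by (simp add: has_vector_derivative_def)
qed

lemma avg_scale_derivative:
  assumes \<phi>: "continuous_on UNIV \<phi>" and f: "Cm_on 1 UNIV f"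
  shows "((\<lambda>s. avg \<phi> s f z) has_vector_derivative
    (\<Sum>l\<in>UNIV. avg (\<lambda>y. coord (Some l) y * \<phi> y) s (pd (Some l) f) z)) (at s)"
proof -
  have f': "Cm_on (Suc 0) UNIV f" using f by simp
  note cont = Cm_continuous[OF f] Cm_continuous[OF Cm_pd[OF f']]
  have "((\<lambda>s. integral Qbox (\<lambda>y. \<phi> (0, y) * f (z + (0, s *\<^sub>R y)))) has_vector_derivative
      integral Qbox (\<lambda>y. \<phi> (0, y) * (\<Sum>l\<in>UNIV. (y $ l) *\<^sub>R pd (Some l) f (z + (0, s *\<^sub>R y))))) (at s within UNIV)"
  proof (rule leibniz_rule_vector_derivative)
    show "((\<lambda>s. \<phi> (0, y) * f (z + (0, s *\<^sub>R y))) has_vector_derivative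
       \<phi> (0, y) * (\<Sum>l\<in>UNIV. (y $ l) *\<^sub>R pd (Some l) f (z + (0, s *\<^sub>R y)))) (at s within UNIV)" for s y
      by (rule has_vector_derivative_mult_right[OF chain_along_space_ray[OF f]])
    show "(\<lambda>y. \<phi> (0, y) * f (z + (0, s *\<^sub>R y))) integrable_on Qbox" for s
      by (rule avg_integrable[OF \<phi> cont(1)])
    show "continuous_on (UNIV \<times> Qbox) (\<lambda>(s, y). \<phi> (0, y) * (\<Sum>l\<in>UNIV. (y $ l) *\<^sub>R pd (Some l) f (z + (0, s *\<^sub>R y))))"
      unfolding split_beta by (intro continuous_intros continuous_on_compose2[OF \<phi>]
        continuous_on_compose2[OF cont(2)]) simp_all
  qed simp_all
  moreover have "integral Qbox (\<lambda>y. \<phi> (0, y) * (\<Sum>l\<in>UNIV. (y $ l) *\<^sub>R pd (Some l) f (z + (0, s *\<^sub>R y))))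
     = (\<Sum>l\<in>UNIV. avg (\<lambda>y. coord (Some l) y * \<phi> y) s (pd (Some l) f) z)"
  proof -
    have "continuous_on UNIV (\<lambda>y. coord (Some l) y * \<phi> y)" for l
      using Cm_continuous[OF Cm_coord[of 0 "Some l"]] \<phi> by (rule continuous_on_mult)
    note int = avg_integrable[OF this cont(2)]
    have "(\<Sum>l\<in>UNIV. avg (\<lambda>y. coord (Some l) y * \<phi> y) s (pd (Some l) f) z)
      = integral Qbox (\<lambda>y. \<Sum>l\<in>UNIV. coord (Some l) (0, y) * \<phi> (0, y) * pd (Some l) f (z + (0, s *\<^sub>R y)))"
      unfolding avg_def by (rule integral_sum[symmetric]) (simp_all only: finite int)
    then show ?thesis by (simp add: sum_distrib_left mult_ac)
  qed
  ultimately show ?thesis by (simp add: avg_def)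
qed

subsection \<open>The bump function\<close>

text \<open>The powers of the positive part are the one-variable source of smooth compactly supported kernels.\<close>

lemma DERIV_pos_part_power:
  "((\<lambda>x::real. max 0 x ^ Suc (Suc m)) has_field_derivative real (Suc (Suc m)) * max 0 x ^ Suc m) (at x)"
proof (cases x "0::real" rule: linorder_cases)
  case less
  then have "((\<lambda>_. 0) has_field_derivative real (Suc (Suc m)) * max 0 x ^ Suc m) (at x)" by simp
  then show ?thesis
    by (rule has_field_derivative_transform_within_open[of _ _ _ "{..<0}"]) (use less in auto)
next
  case greater
  have "((\<lambda>x::real. x ^ Suc (Suc m)) has_field_derivative real (Suc (Suc m)) * x ^ Suc m) (at x)"
    using DERIV_pow[of "Suc (Suc m)" x] by simp
  then have "((\<lambda>x::real. x ^ Suc (Suc m)) has_field_derivative real (Suc (Suc m)) * max 0 x ^ Suc m) (at x)"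
    using greater by simp
  then show ?thesis
    by (rule has_field_derivative_transform_within_open[of _ _ _ "{0<..}"]) (use greater in auto)
next
  case equal
  have "((\<lambda>h::real. max 0 h ^ Suc m) \<longlongrightarrow> max 0 0 ^ Suc m) (at 0)"
    by (intro tendsto_intros)
  then have "((\<lambda>h::real. max 0 h ^ Suc m) \<longlongrightarrow> 0) (at 0)" by simp
  then have "((\<lambda>h::real. max 0 h ^ Suc (Suc m) / h) \<longlongrightarrow> 0) (at 0)"
    by (rule Lim_transform_eventually) (auto simp: eventually_at_filter max_def)
  then show ?thesis using equal by (simp add: DERIV_def)
qed

text \<open>This is \<open>1 - |x|\<^sup>2\<close>, written in coordinates so that the closure properties of \<open>C\<^sup>m\<close> apply.\<close>

definition gap :: "'n::finite spacetime \<Rightarrow> real" where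
  "gap z = 1 - (\<Sum>j\<in>UNIV. coord (Some j) z * coord (Some j) z)"

lemma gap_eq: "gap z = 1 - (norm (snd z))\<^sup>2"
  by (simp add: gap_def norm_vec_def L2_set_def power2_eq_square sum_nonneg)

definition bump :: "'n::finite spacetime \<Rightarrow> real" where
  "bump z = max 0 (gap z) ^ 5"

text \<open>The factor \<open>10\<close> is chosen such that the gradient of \<open>bump\<close> is \<open>- x * mass_kernel\<close>, see \<open>pd_bump\<close>.\<close>

definition mass_kernel :: "'n::finite spacetime \<Rightarrow> real" where
  "mass_kernel z = 10 * max 0 (gap z) ^ 4"

lemma has_pd_gap: "has_pd gap (- 2 * (case i of None \<Rightarrow> 0 | Some l \<Rightarrow> coord (Some l) z)) i z"
proof -
  have "has_pd gap (0 - (\<Sum>j\<in>UNIV. coord (Some j) z * (if Some j = i then 1 else 0)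
      + (if Some j = i then 1 else 0) * coord (Some j) z)) i z"
    unfolding gap_def[abs_def] by (intro has_pd_diff has_pd_const has_pd_sum has_pd_mult has_pd_coord)
  moreover have "(0 - (\<Sum>j\<in>UNIV. coord (Some j) z * (if Some j = i then 1 else 0)
      + (if Some j = i then 1 else 0) * coord (Some j) z)) = - 2 * (case i of None \<Rightarrow> 0 | Some l \<Rightarrow> coord (Some l) z)"
  proof (cases i)
    case (Some l)
    have "coord (Some j) z * (if Some j = i then 1 else 0) + (if Some j = i then 1 else 0) * coord (Some j) z
        = (if j = l then 2 * coord (Some l) z else 0)" for j
      using Some by simp
    then show ?thesis using Some by (simp only: sum.delta) simp
  qed simp
  ultimately show ?thesis by simp
qed

lemma Cm_gap: "Cm_on m UNIV gap"
  unfolding gap_def[abs_def] by (intro Cm_diff Cm_const Cm_sum Cm_mult Cm_coord)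

lemma Cm_pos_part_power:
  fixes g :: "'n::finite spacetime \<Rightarrow> real"
  shows "Cm_on m UNIV g \<Longrightarrow> m \<le> k \<Longrightarrow> Cm_on m UNIV (\<lambda>z. max 0 (g z) ^ Suc k)"
proof (induction m arbitrary: k)
  case 0
  then have "continuous_on UNIV g" by simp
  then have "continuous_on UNIV (\<lambda>z. max 0 (g z) ^ Suc k)" by (intro continuous_intros)
  then show ?case by simp
next
  case (Suc m)
  then obtain k' where k: "k = Suc k'" "m \<le> k'" by (cases k) auto
  show ?case unfolding k
  proof (rule Cm_SucI[where g = "\<lambda>i z. (real (Suc (Suc k')) * max 0 (g z) ^ Suc k') * pd i g z"])
    show "has_pd (\<lambda>z. max 0 (g z) ^ Suc (Suc k')) (real (Suc (Suc k')) * max 0 (g z) ^ Suc k' * pd i g z) i z" for i z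
      by (rule has_pd_chain[OF DERIV_pos_part_power Cm_has_pd_UNIV[OF Suc.prems(1)]])
    show "Cm_on m UNIV (\<lambda>z. real (Suc (Suc k')) * max 0 (g z) ^ Suc k' * pd i g z)" for i
      by (intro Cm_mult Cm_const Suc.IH[OF Cm_SucD[OF Suc.prems(1)] k(2)] Cm_pd[OF Suc.prems(1)])
  qed
qed

lemma gap_outside:
  assumes "1 < norm y" shows "max 0 (gap (t, y)) = 0"
proof -
  have "1 < (norm y)\<^sup>2" using assms by (simp add: one_less_power)
  then show ?thesis by (simp add: gap_eq)
qed

lemma kernel_bump: "space_kernel 4 bump"
  unfolding space_kernel_def
proof (intro conjI allI impI)
  show "Cm_on 4 UNIV bump"
    using Cm_pos_part_power[OF Cm_gap, of 4 4] by (simp add: bump_def[abs_def] eval_nat_numeral)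
next
  show "bump (t, y) = bump (0, y)" for t y by (simp add: bump_def gap_eq)
  show "1 < norm y \<Longrightarrow> bump (t, y) = 0" for t y by (simp add: bump_def gap_outside)
qed

lemma kernel_mass: "space_kernel 3 mass_kernel"
  unfolding space_kernel_def
proof (intro conjI allI impI)
  show "Cm_on 3 UNIV mass_kernel"
    using Cm_cmult[OF Cm_pos_part_power[OF Cm_gap, of 3 3], of 10] by (simp add: mass_kernel_def[abs_def] eval_nat_numeral)
next
  show "mass_kernel (t, y) = mass_kernel (0, y)" for t y by (simp add: mass_kernel_def gap_eq)
  show "1 < norm y \<Longrightarrow> mass_kernel (t, y) = 0" for t y by (simp add: mass_kernel_def gap_outside)
qed

lemma pd_bump: "pd (Some l) bump z = - (coord (Some l) z * mass_kernel z)"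
proof (rule pd_eq)
  have "has_pd bump (real (Suc (Suc 3)) * max 0 (gap z) ^ Suc 3 * (- 2 * coord (Some l) z)) (Some l) z"
    using has_pd_chain[OF DERIV_pos_part_power[of 3] has_pd_gap[where i = "Some l" and z = z]]
    by (simp add: bump_def[abs_def] eval_nat_numeral)
  then show "has_pd bump (- (coord (Some l) z * mass_kernel z)) (Some l) z"
    by (simp add: mass_kernel_def eval_nat_numeral algebra_simps)
qed

definition mass :: "'n::finite itself \<Rightarrow> real" where
  "mass _ = integral Qbox (\<lambda>y :: real ^ 'n. mass_kernel (0, y))"

lemma avg_mass_0: "avg mass_kernel 0 f (z :: 'n::finite spacetime) = mass TYPE('n) * f z"
  by (simp add: avg_def mass_def zero_prod_def[symmetric])

lemma mass_nonzero: "mass TYPE('n::finite) \<noteq> 0"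
proof
  assume 0: "mass TYPE('n) = 0"
  have cont: "continuous_on Qbox (\<lambda>y :: real ^ 'n. mass_kernel (0, y))"
    by (intro continuous_on_compose2[OF kernel_continuous[OF kernel_mass]] continuous_intros) simp
  have int: "((\<lambda>y :: real ^ 'n. mass_kernel (0, y)) has_integral 0) Qbox"
    using integrable_integral[OF integrable_continuous[OF cont]] 0 by (simp add: mass_def)
  have "(0 :: real ^ 'n) \<in> box (vec (-2)) (vec 2)" by (simp add: mem_box_cart)
  then have ne: "box (vec (-2)) (vec 2 :: real ^ 'n) \<noteq> {}" by blast
  have "mass_kernel (0, 0 :: real ^ 'n) = 0"
    by (rule has_integral_0_cbox_imp_0[OF cont _ int ne]) (simp_all add: mass_kernel_def ball_in_Qbox)
  then show False by (simp add: mass_kernel_def gap_eq)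
qed

section \<open>Integrals over scales for data vanishing at infinity\<close>

text \<open>The class of data for which the Poisson equation is solved. It is stable under differentiation.\<close>

definition Cm_decaying :: "nat \<Rightarrow> ('n::finite spacetime \<Rightarrow> real) \<Rightarrow> bool" where
  "Cm_decaying m f \<longleftrightarrow> Cm_on m UNIV f \<and> Cm_vanishes_at_infinity m f"

lemma Cm_vanishes_SucD: "Cm_vanishes_at_infinity (Suc m) f \<Longrightarrow> Cm_vanishes_at_infinity m f"
  by (induction m arbitrary: f) auto

lemma Cm_decaying_SucD: "Cm_decaying (Suc m) f \<Longrightarrow> Cm_decaying m f"
  unfolding Cm_decaying_def using Cm_SucD Cm_vanishes_SucD by blast

lemma Cm_decaying_pd: "Cm_decaying (Suc m) f \<Longrightarrow> Cm_decaying m (pd i f)"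
  unfolding Cm_decaying_def using Cm_pd by auto

lemma Cm_decaying_continuous: "Cm_decaying m f \<Longrightarrow> continuous_on UNIV f"
  unfolding Cm_decaying_def using Cm_continuous by blast

lemma Cm_decaying_Cm: "Cm_decaying m f \<Longrightarrow> Cm_on m UNIV f"
  unfolding Cm_decaying_def by blast

lemma Cm_decaying_vanishes: "Cm_decaying m f \<Longrightarrow> vanishes_at_infinity f"
  unfolding Cm_decaying_def by (cases m) auto

lemma vanishing_bounded:
  fixes f :: "'n::finite spacetime \<Rightarrow> real"
  assumes cont: "continuous_on UNIV f" and v: "vanishes_at_infinity f"
  shows "\<exists>C. \<forall>t x. \<bar>t\<bar> \<le> T \<longrightarrow> \<bar>f (t, x)\<bar> \<le> C"
proof -
  obtain R where R: "\<And>t x. \<bar>t\<bar> \<le> T \<Longrightarrow> R \<le> norm x \<Longrightarrow> \<bar>f (t, x)\<bar> < 1"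
    using v unfolding vanishes_at_infinity_def by (metis real_norm_def zero_less_one)
  have "compact (f ` ({-T..T} \<times> cball 0 R))"
    by (intro compact_continuous_image continuous_on_subset[OF cont] compact_Times) auto
  then obtain C where C: "\<And>z. z \<in> {-T..T} \<times> cball 0 R \<Longrightarrow> \<bar>f z\<bar> \<le> C"
    unfolding compact_eq_bounded_closed bounded_iff by auto
  have "\<bar>f (t, x)\<bar> \<le> max C 1" if "\<bar>t\<bar> \<le> T" for t x
  proof (cases "R \<le> norm x")
    case True then show ?thesis using R[OF that] by fastforce
  next
    case False
    then have "\<bar>f (t, x)\<bar> \<le> C" using that by (intro C) auto
    then show ?thesis by simp
  qed
  then show ?thesis by blast
qed

text \<open>The average at scale \<open>1 / r\<close>. The value at \<open>r = 0\<close>, scale infinity, is the limit for functions that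
  vanish at infinity.\<close>

definition far_avg :: "('n::finite spacetime \<Rightarrow> real) \<Rightarrow> ('n spacetime \<Rightarrow> real) \<Rightarrow> real \<Rightarrow> 'n spacetime \<Rightarrow> real" where
  "far_avg \<psi> f r z = (if r = 0 then 0 else avg \<psi> (1 / r) f z)"

text \<open>For each \<open>y \<noteq> 0\<close> the points \<open>x + y / r\<close> leave every bounded set as \<open>r\<close> tends to \<open>0\<close>, so the integrand tends to \<open>0\<close>
  pointwise, and it is dominated because \<open>f\<close> is bounded for bounded times.\<close>

lemma far_avg_tendsto_0:
  fixes f :: "'n::finite spacetime \<Rightarrow> real"
  assumes \<psi>: "continuous_on UNIV \<psi>" and f: "continuous_on UNIV f" and v: "vanishes_at_infinity f"
    and r: "\<And>k. 0 \<le> r k" "r \<longlonglongrightarrow> 0" and w: "w \<longlonglongrightarrow> z"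
  shows "(\<lambda>k. far_avg \<psi> f (r k) (w k)) \<longlonglongrightarrow> 0"
proof -
  \<comment> \<open>The point \<open>y = 0\<close>, the only one where convergence fails, is removed; it has measure zero.\<close>
  define F where "F k y = (if y = 0 \<or> r k = 0 then 0 else \<psi> (0, y) * f (w k + (0, (1 / r k) *\<^sub>R y)))" for k y
  have "Bseq w" using w convergent_def convergent_imp_Bseq by blast
  then obtain T where T: "T > 0" "\<And>k. norm (w k) \<le> T" by (auto simp: Bseq_def)
  have Tf: "\<bar>fst (w k)\<bar> \<le> T" and Ts: "norm (snd (w k)) \<le> T" for k
    using T(2)[of k] norm_fst_le[of "fst (w k)" "snd (w k)"] norm_snd_le[of "snd (w k)" "fst (w k)"] by auto
  obtain C where C: "\<And>t x. \<bar>t\<bar> \<le> T \<Longrightarrow> \<bar>f (t, x)\<bar> \<le> C" using vanishing_bounded[OF f v] by metis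
  have int: "F k integrable_on Qbox" "integral Qbox (F k) = far_avg \<psi> f (r k) (w k)" for k
  proof -
    have "F k integrable_on Qbox \<and> integral Qbox (F k) = far_avg \<psi> f (r k) (w k)"
    proof (cases "r k = 0")
      case True
      then have "F k = (\<lambda>_. 0)" by (auto simp: F_def)
      then show ?thesis using True by (simp add: far_avg_def integrable_0)
    next
      case False
      let ?G = "\<lambda>y. \<psi> (0, y) * f (w k + (0, (1 / r k) *\<^sub>R y))"
      have eq: "F k y = ?G y" if "y \<in> Qbox - {0}" for y using that False by (simp add: F_def)
      have "F k integrable_on Qbox"
        by (rule integrable_spike[OF avg_integrable[OF \<psi> f] negligible_sing]) (rule eq)
      moreover have "integral Qbox ?G = integral Qbox (F k)"
        by (rule integral_spike[OF negligible_sing]) (rule eq)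
      ultimately show ?thesis using False by (simp add: far_avg_def avg_def)
    qed
    then show "F k integrable_on Qbox" "integral Qbox (F k) = far_avg \<psi> f (r k) (w k)" by auto
  qed
  have lim: "(\<lambda>k. F k y) \<longlonglongrightarrow> 0" for y
  proof (cases "y = 0")
    case True then show ?thesis by (simp add: F_def)
  next
    case False
    show ?thesis
    proof (rule LIMSEQ_I)
      fix e :: real assume e: "e > 0"
      define e' where "e' = e / (\<bar>\<psi> (0, y)\<bar> + 1)"
      have e': "e' > 0" using e by (simp add: e'_def)
      obtain R where R: "\<And>t x. \<bar>t\<bar> \<le> T \<Longrightarrow> R \<le> norm x \<Longrightarrow> \<bar>f (t, x)\<bar> < e'"
        using v e' unfolding vanishes_at_infinity_def by (metis real_norm_def)
      \<comment> \<open>Scales above \<open>D / norm y\<close> move the argument of \<open>f\<close> beyond distance \<open>R\<close>.\<close>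
      define D where "D = \<bar>R\<bar> + T"
      have D: "D > 0" using T by (simp add: D_def)
      have "norm y / D > 0" using False D by simp
      with r(2) have "\<forall>\<^sub>F k in sequentially. r k < norm y / D" by (rule order_tendstoD)
      then obtain N where N: "\<And>k. k \<ge> N \<Longrightarrow> r k < norm y / D" by (auto simp: eventually_sequentially)
      have "norm (F k y - 0) < e" if "k \<ge> N" for k
      proof (cases "r k = 0")
        case True then show ?thesis using e by (simp add: F_def)
      next
        case nz: False
        then have rk: "r k > 0" using r(1)[of k] by simp
        have "D < norm y / r k" using N[OF that] rk D by (simp add: field_simps)
        also have "norm y / r k = norm ((1 / r k) *\<^sub>R y)" using rk by simp
        also have "\<dots> \<le> norm (snd (w k) + (1 / r k) *\<^sub>R y) + norm (snd (w k))"
          by (metis add.commute norm_triangle_sub add_diff_cancel_left' norm_minus_commute)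
        finally have "R \<le> norm (snd (w k) + (1 / r k) *\<^sub>R y)" using Ts[of k] by (simp add: D_def)
        from R[OF Tf this] have "\<bar>f (w k + (0, (1 / r k) *\<^sub>R y))\<bar> < e'"
          by (metis add.right_neutral fst_conv plus_prod_def snd_conv)
        then have "\<bar>F k y\<bar> \<le> \<bar>\<psi> (0, y)\<bar> * e'"
          using nz False by (simp add: F_def abs_mult mult_left_mono)
        also have "\<dots> < (\<bar>\<psi> (0, y)\<bar> + 1) * e'" using e' by simp
        also have "\<dots> = e" by (simp add: e'_def)
        finally show ?thesis by simp
      qed
      then show "\<exists>N. \<forall>k\<ge>N. norm (F k y - 0) < e" by blast
    qed
  qed
  have "(\<lambda>k. integral Qbox (F k)) \<longlonglongrightarrow> integral (Qbox :: (real ^ 'n) set) (\<lambda>_. 0)"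
  proof (rule dominated_convergence(2)[where h = "\<lambda>y. \<bar>\<psi> (0, y)\<bar> * \<bar>C\<bar>"])
    show "(\<lambda>y. \<bar>\<psi> (0, y)\<bar> * \<bar>C\<bar>) integrable_on Qbox"
      by (intro integrable_continuous continuous_intros continuous_on_compose2[OF \<psi>]) simp
    show "norm (F k y) \<le> \<bar>\<psi> (0, y)\<bar> * \<bar>C\<bar>" for k y
    proof -
      have "\<bar>f (w k + (0, (1 / r k) *\<^sub>R y))\<bar> \<le> \<bar>C\<bar>"
        using C[OF Tf, of k "snd (w k) + (1 / r k) *\<^sub>R y"]
        by (smt (verit) add.right_neutral fst_conv plus_prod_def snd_conv)
      then show ?thesis by (simp add: F_def abs_mult mult_left_mono)
    qed
  qed (use int(1) lim in auto)
  then show ?thesis by (simp add: int(2))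
qed

lemma continuous_far_avg:
  fixes f :: "'n::finite spacetime \<Rightarrow> real"
  assumes \<psi>: "continuous_on UNIV \<psi>" and f: "continuous_on UNIV f" and v: "vanishes_at_infinity f"
  shows "continuous_on (cbox 0 1 \<times> UNIV) (\<lambda>(r, z). far_avg \<psi> f r z)"
proof (rule continuous_on_sequentiallyI)
  fix u :: "nat \<Rightarrow> real \<times> 'n spacetime" and p
  assume u: "\<forall>k. u k \<in> cbox 0 1 \<times> UNIV" and p: "p \<in> cbox 0 1 \<times> UNIV" and lim: "u \<longlonglongrightarrow> p"
  have u0: "0 \<le> fst (u k)" for k using u by (metis atLeastAtMost_iff cbox_interval mem_Times_iff)
  have lims: "(\<lambda>k. fst (u k)) \<longlonglongrightarrow> fst p" "(\<lambda>k. snd (u k)) \<longlonglongrightarrow> snd p"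
    using lim by (auto intro: tendsto_fst tendsto_snd)
  have "(\<lambda>k. far_avg \<psi> f (fst (u k)) (snd (u k))) \<longlonglongrightarrow> far_avg \<psi> f (fst p) (snd p)"
  proof (cases "fst p = 0")
    case True
    with far_avg_tendsto_0[OF \<psi> f v u0 _ lims(2)] lims(1) show ?thesis by (simp add: far_avg_def)
  next
    case False
    then have pos: "fst p > 0" using p by (auto simp: mem_Times_iff)
    have "(\<lambda>k. (1 / fst (u k), snd (u k))) \<longlonglongrightarrow> (1 / fst p, snd p)"
      using False by (intro tendsto_intros lims) auto
    from continuous_on_tendsto_compose[OF continuous_avg[OF \<psi> f, of UNIV] this]
    have 1: "(\<lambda>k. avg \<psi> (1 / fst (u k)) f (snd (u k))) \<longlonglongrightarrow> far_avg \<psi> f (fst p) (snd p)"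
      using False by (simp add: far_avg_def)
    have "\<forall>\<^sub>F k in sequentially. fst (u k) > 0" using lims(1) pos by (rule order_tendstoD)
    then have "\<forall>\<^sub>F k in sequentially. avg \<psi> (1 / fst (u k)) f (snd (u k)) = far_avg \<psi> f (fst (u k)) (snd (u k))"
      by (rule eventually_mono) (simp add: far_avg_def)
    with 1 show ?thesis by (rule Lim_transform_eventually)
  qed
  then show "(\<lambda>k. case u k of (r, z) \<Rightarrow> far_avg \<psi> f r z) \<longlonglongrightarrow> (case p of (r, z) \<Rightarrow> far_avg \<psi> f r z)"
    by (simp add: split_beta)
qed

text \<open>In the variable \<open>s = 1 / r\<close> this is \<open>- \<integral> s\<^sup>-\<^sup>2 avg \<psi> s f ds\<close> over \<open>s \<ge> 1\<close>. For a third derivative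
  \<open>\<psi>\<close> of the bump function it is formally the same third derivative of \<open>\<integral> s avg bump s f ds\<close>, an integral
  that itself need not converge.\<close>

definition far_integral :: "('n::finite spacetime \<Rightarrow> real) \<Rightarrow> ('n spacetime \<Rightarrow> real) \<Rightarrow> 'n spacetime \<Rightarrow> real" where
  "far_integral \<psi> f z = - integral (cbox 0 1) (\<lambda>r. far_avg \<psi> f r z)"

text \<open>The scales up to \<open>1\<close>, where no renormalisation is needed.\<close>

definition near_potential :: "('n::finite spacetime \<Rightarrow> real) \<Rightarrow> 'n spacetime \<Rightarrow> real" where
  "near_potential f z = integral (cbox 0 1) (\<lambda>s. s * avg bump s f z)"

text \<open>The operators below lose no smoothness. Derivatives in time commute with them; derivatives in space may lead
  to a different operator of the same kind and are treated separately.\<close>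

definition regular_op :: "(('n::finite spacetime \<Rightarrow> real) \<Rightarrow> 'n spacetime \<Rightarrow> real) \<Rightarrow> bool" where
  "regular_op T \<longleftrightarrow> (\<forall>m f. Cm_decaying m f \<longrightarrow> Cm_on m UNIV (T f)) \<and>
     (\<forall>f. Cm_decaying 1 f \<longrightarrow> pd None (T f) = T (pd None f))"

text \<open>Induction on the order of smoothness: a time derivative reproduces the operator with differentiated data,
  and for a space derivative the last premise transfers the induction hypothesis.\<close>

lemma regular_opI:
  assumes "\<And>f. Cm_decaying 0 f \<Longrightarrow> continuous_on UNIV (T f)"
    and "\<And>f z. Cm_decaying 1 f \<Longrightarrow> has_pd (T f) (T (pd None f) z) None z"
    and "\<And>f z l. Cm_decaying 1 f \<Longrightarrow> has_pd (T f) (S l f z) (Some l) z"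
    and "\<And>m f l. Cm_decaying (Suc m) f \<Longrightarrow> (\<And>g. Cm_decaying m g \<Longrightarrow> Cm_on m UNIV (T g)) \<Longrightarrow> Cm_on m UNIV (S l f)"
  shows "regular_op T"
  unfolding regular_op_def
proof (intro conjI allI impI)
  fix f :: "'a spacetime \<Rightarrow> real" assume "Cm_decaying 1 f"
  then show "pd None (T f) = T (pd None f)" using pd_eq[OF assms(2)] by blast
next
  fix m and f :: "'a spacetime \<Rightarrow> real"
  show "Cm_decaying m f \<Longrightarrow> Cm_on m UNIV (T f)"
  proof (induction m arbitrary: f)
    case 0 then show ?case using assms(1) by simp
  next
    case (Suc m)
    have 1: "Cm_decaying 1 f" using Suc.prems by (induction m) (auto dest: Cm_decaying_SucD)
    show ?case
    proof (rule Cm_SucI[where g = "\<lambda>i. case i of None \<Rightarrow> T (pd None f) | Some l \<Rightarrow> S l f"])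
      show "has_pd (T f) ((case i of None \<Rightarrow> T (pd None f) | Some l \<Rightarrow> S l f) z) i z" for i z
        using assms(2,3)[OF 1] by (cases i) auto
      show "Cm_on m UNIV (case i of None \<Rightarrow> T (pd None f) | Some l \<Rightarrow> S l f)" for i
        using Suc.IH[OF Cm_decaying_pd[OF Suc.prems]] assms(4)[OF Suc.prems Suc.IH] by (cases i) auto
    qed
  qed
qed

lemma has_pd_far_integral:
  assumes \<psi>: "continuous_on UNIV \<psi>" and f: "Cm_decaying 1 f"
  shows "has_pd (far_integral \<psi> f) (far_integral \<psi> (pd i f) z) i z"
proof -
  have f': "Cm_decaying (Suc 0) f" using f by simp
  note C = Cm_decaying_Cm[OF f] and f0 = Cm_decaying_SucD[OF f'] and fi = Cm_decaying_pd[OF f']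
  have "has_pd (\<lambda>z. integral (cbox 0 1) (\<lambda>r. far_avg \<psi> f r z)) (integral (cbox 0 1) (\<lambda>r. far_avg \<psi> (pd i f) r z)) i z"
  proof (rule has_pd_integral)
    show "has_pd (far_avg \<psi> f r) (far_avg \<psi> (pd i f) r z) i z" for r z
      using has_pd_avg[OF \<psi> C] by (cases "r = 0") (simp_all add: far_avg_def[abs_def] has_pd_const)
    show "continuous_on (cbox 0 1 \<times> UNIV) (\<lambda>(r, z). far_avg \<psi> (pd i f) r z)"
      by (rule continuous_far_avg[OF \<psi> Cm_decaying_continuous[OF fi] Cm_decaying_vanishes[OF fi]])
    show "(\<lambda>r. far_avg \<psi> f r z) integrable_on cbox 0 1" for z
      by (rule integrable_param[OF continuous_far_avg[OF \<psi> Cm_decaying_continuous[OF f0] Cm_decaying_vanishes[OF f0]]]) simp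
  qed
  from has_pd_diff[OF has_pd_const[of 0] this] show ?thesis by (simp add: far_integral_def[abs_def])
qed

lemma continuous_far_integral:
  assumes \<psi>: "continuous_on UNIV \<psi>" and f: "Cm_decaying 0 f"
  shows "continuous_on UNIV (far_integral \<psi> f)"
  unfolding far_integral_def[abs_def]
  by (intro continuous_on_minus continuous_on_integral_param[OF continuous_far_avg[OF \<psi> Cm_decaying_continuous[OF f] Cm_decaying_vanishes[OF f]]])

lemma regular_far_integral: "continuous_on UNIV \<psi> \<Longrightarrow> regular_op (far_integral \<psi>)"
  by (rule regular_opI[where S = "\<lambda>l f. far_integral \<psi> (pd (Some l) f)"])
    (simp_all add: continuous_far_integral has_pd_far_integral Cm_decaying_pd)

lemma continuous_near_integrand:
  fixes f :: "'n::finite spacetime \<Rightarrow> real"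
  assumes "continuous_on UNIV f"
  shows "continuous_on S (\<lambda>(s, z). s * avg bump s f z)"
  using continuous_on_mult[OF continuous_on_fst[OF continuous_on_id]
      continuous_avg[OF kernel_continuous[OF kernel_bump] assms]]
  by (simp add: split_beta)

lemma has_pd_near:
  assumes f: "Cm_on 1 UNIV f"
  shows "has_pd (near_potential f) (near_potential (pd i f) z) i z"
proof -
  have f': "Cm_on (Suc 0) UNIV f" using f by simp
  note b = kernel_continuous[OF kernel_bump]
  show ?thesis
    unfolding near_potential_def[abs_def]
  proof (rule has_pd_integral)
    show "has_pd (\<lambda>z. s * avg bump s f z) (s * avg bump s (pd i f) z) i z" for s z
      by (rule has_pd_cmult[OF has_pd_avg[OF b f]])
    show "(\<lambda>s. s * avg bump s f z) integrable_on cbox 0 1" for z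
      by (rule integrable_param[OF continuous_near_integrand[OF Cm_continuous[OF f], where S = "_ \<times> UNIV"]]) simp
  qed (rule continuous_near_integrand[OF Cm_continuous[OF Cm_pd[OF f']]])
qed

lemma continuous_near:
  fixes f :: "'n::finite spacetime \<Rightarrow> real"
  assumes "continuous_on UNIV f" shows "continuous_on UNIV (near_potential f)"
  unfolding near_potential_def[abs_def]
  by (rule continuous_on_integral_param[OF continuous_near_integrand[OF assms]])

lemma regular_near: "regular_op near_potential"
  by (rule regular_opI[where S = "\<lambda>l f. near_potential (pd (Some l) f)"])
    (simp_all add: Cm_decaying_continuous continuous_near has_pd_near Cm_decaying_pd Cm_decaying_Cm)

section \<open>Radial primitives\<close>

text \<open>The potential of the Poincare lemma for the spatial one-form \<open>F\<close>, normalised to vanish at \<open>x = 0\<close>.\<close>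

definition radial_primitive :: "('n::finite \<Rightarrow> 'n spacetime \<Rightarrow> real) \<Rightarrow> 'n spacetime \<Rightarrow> real" where
  "radial_primitive F z = integral (cbox 0 1) (\<lambda>\<theta>. \<Sum>i\<in>UNIV. coord (Some i) z * F i (fst z, \<theta> *\<^sub>R snd z))"

lemma has_pd_dilate:
  fixes g :: "'n::finite spacetime \<Rightarrow> 'b::real_normed_algebra_1"
  assumes "has_pd g d i (fst z, \<theta> *\<^sub>R snd z)"
  shows "has_pd (\<lambda>z. g (fst z, \<theta> *\<^sub>R snd z)) ((if i = None then 1 else \<theta>) *\<^sub>R d) i z"
proof -
  define \<sigma> :: real where "\<sigma> = (if i = None then 1 else \<theta>)"
  have "((\<lambda>h. g ((fst z, \<theta> *\<^sub>R snd z) + h *\<^sub>R dir i)) has_vector_derivative d) (at (\<sigma> * 0))"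
    using assms by (simp add: has_pd_def)
  moreover have "((\<lambda>h. \<sigma> * h) has_vector_derivative \<sigma>) (at 0)"
    by (auto intro!: derivative_eq_intros)
  ultimately have "((\<lambda>h. g ((fst z, \<theta> *\<^sub>R snd z) + (\<sigma> * h) *\<^sub>R dir i)) has_vector_derivative \<sigma> *\<^sub>R d) (at 0)"
    using vector_diff_chain_at[of "\<lambda>h. \<sigma> * h" \<sigma> 0 "\<lambda>h. g ((fst z, \<theta> *\<^sub>R snd z) + h *\<^sub>R dir i)" d]
    by (simp add: o_def)
  moreover have "(fst z, \<theta> *\<^sub>R snd z) + (\<sigma> * h) *\<^sub>R dir i = (fst (z + h *\<^sub>R dir i), \<theta> *\<^sub>R snd (z + h *\<^sub>R dir i))" for h
    by (cases i) (simp_all add: \<sigma>_def scaleR_add_right)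
  ultimately show ?thesis by (simp add: has_pd_def \<sigma>_def)
qed

lemma continuous_radial_integrand:
  assumes "\<And>i. continuous_on UNIV (F i)"
  shows "continuous_on (S \<times> T) (\<lambda>(\<theta>, z). \<Sum>i\<in>UNIV. coord (Some i) z * F i (fst z, \<theta> *\<^sub>R snd z))"
  unfolding split_beta
  by (intro continuous_intros continuous_on_compose2[OF assms]
      continuous_on_compose2[OF Cm_continuous[OF Cm_coord[of 0]]]) simp_all

lemma continuous_radial:
  "(\<And>i. continuous_on UNIV (F i)) \<Longrightarrow> continuous_on UNIV (radial_primitive F)"
  unfolding radial_primitive_def[abs_def]
  by (rule continuous_on_integral_param[OF continuous_radial_integrand])

lemma has_pd_radial:
  assumes F: "\<And>i. Cm_on 1 UNIV (F i)"
  shows "has_pd (radial_primitive F) (integral (cbox 0 1) (\<lambda>\<theta>. \<Sum>i\<in>UNIV.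
      coord (Some i) z * ((if j = None then 1 else \<theta>) *\<^sub>R pd j (F i) (fst z, \<theta> *\<^sub>R snd z))
      + (if Some i = j then 1 else 0) * F i (fst z, \<theta> *\<^sub>R snd z))) j z"
proof -
  have F': "Cm_on (Suc 0) UNIV (F i)" for i using F by simp
  note cF = Cm_continuous[OF F] and cP = Cm_continuous[OF Cm_pd[OF F']]
  show ?thesis
    unfolding radial_primitive_def[abs_def]
  proof (rule has_pd_integral)
    show "has_pd (\<lambda>z. \<Sum>i\<in>UNIV. coord (Some i) z * F i (fst z, \<theta> *\<^sub>R snd z))
      (\<Sum>i\<in>UNIV. coord (Some i) z * ((if j = None then 1 else \<theta>) *\<^sub>R pd j (F i) (fst z, \<theta> *\<^sub>R snd z))
      + (if Some i = j then 1 else 0) * F i (fst z, \<theta> *\<^sub>R snd z)) j z" for \<theta> z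
      by (intro has_pd_sum has_pd_mult has_pd_coord has_pd_dilate Cm_has_pd_UNIV[OF F'])
    show "(\<lambda>\<theta>. \<Sum>i\<in>UNIV. coord (Some i) z * F i (fst z, \<theta> *\<^sub>R snd z)) integrable_on cbox 0 1" for z
      by (rule integrable_param[OF continuous_radial_integrand[OF cF, where T = UNIV]]) simp
    show "continuous_on (cbox 0 1 \<times> UNIV) (\<lambda>(\<theta>, z). \<Sum>i\<in>UNIV.
      coord (Some i) z * ((if j = None then 1 else \<theta>) *\<^sub>R pd j (F i) (fst z, \<theta> *\<^sub>R snd z))
      + (if Some i = j then 1 else 0) * F i (fst z, \<theta> *\<^sub>R snd z))"
      unfolding split_beta
      by (cases "j = None"; simp only: if_True if_False; intro continuous_intros continuous_on_compose2[OF cF]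
         continuous_on_compose2[OF cP] continuous_on_compose2[OF Cm_continuous[OF Cm_coord[of 0]]])
        simp_all
  qed
qed

lemma has_pd_radial_time:
  assumes "\<And>i. Cm_on 1 UNIV (F i)"
  shows "has_pd (radial_primitive F) (radial_primitive (\<lambda>i. pd None (F i)) z) None z"
  using has_pd_radial[OF assms, where j = None] by (simp add: radial_primitive_def)

lemma ray_derivative:
  assumes "Cm_on 1 UNIV f"
  shows "((\<lambda>\<theta>. f (fst z, \<theta> *\<^sub>R snd z)) has_vector_derivative
    (\<Sum>l\<in>UNIV. coord (Some l) z * pd (Some l) f (fst z, \<theta> *\<^sub>R snd z))) (at \<theta> within T)"
  using chain_along_space_ray[OF assms, of "(fst z, 0)" "snd z"] by simp

lemma radial_gradient:
  assumes "Cm_on 1 UNIV g"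
  shows "radial_primitive (\<lambda>i. pd (Some i) g) z = g z - g (fst z, 0)"
proof -
  have "((\<lambda>\<theta>. \<Sum>i\<in>UNIV. coord (Some i) z * pd (Some i) g (fst z, \<theta> *\<^sub>R snd z)) has_integral
     (g (fst z, 1 *\<^sub>R snd z) - g (fst z, 0 *\<^sub>R snd z))) {0..1}"
    by (rule fundamental_theorem_of_calculus) (simp_all only: ray_derivative[OF assms] zero_le_one)
  then show ?thesis by (simp add: radial_primitive_def integral_unique)
qed

text \<open>If \<open>F\<close> is closed, the derivative of the integrand is \<open>d/d\<theta> (\<theta> F\<^sub>l (t, \<theta> x))\<close>, whose integral is
  \<open>F\<^sub>l (t, x)\<close>.\<close>

lemma has_pd_radial_space:
  assumes F: "\<And>i. Cm_on 1 UNIV (F i)" and closed: "\<And>i l. pd (Some l) (F i) = pd (Some i) (F l)"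
  shows "has_pd (radial_primitive F) (F l z) (Some l) z"
proof -
  define D where "D \<theta> = (\<Sum>i\<in>UNIV. coord (Some i) z * pd (Some i) (F l) (fst z, \<theta> *\<^sub>R snd z))" for \<theta>
  have "((\<lambda>\<theta>. \<theta> * F l (fst z, \<theta> *\<^sub>R snd z)) has_vector_derivative \<theta> * D \<theta> + 1 * F l (fst z, \<theta> *\<^sub>R snd z))
      (at \<theta> within {0..1})" for \<theta>
    unfolding D_def by (rule has_vector_derivative_mult[OF has_vector_derivative_id ray_derivative[OF F]])
  then have "((\<lambda>\<theta>. \<theta> * D \<theta> + 1 * F l (fst z, \<theta> *\<^sub>R snd z)) has_integral
     (1 * F l (fst z, 1 *\<^sub>R snd z) - 0 * F l (fst z, 0 *\<^sub>R snd z))) {0..1}"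
    by (intro fundamental_theorem_of_calculus) simp_all
  then have 1: "integral (cbox 0 1) (\<lambda>\<theta>. \<theta> * D \<theta> + 1 * F l (fst z, \<theta> *\<^sub>R snd z)) = F l z"
    by (simp add: integral_unique)
  have "(\<Sum>i\<in>UNIV. coord (Some i) z * ((if Some l = None then 1 else \<theta>) *\<^sub>R pd (Some l) (F i) (fst z, \<theta> *\<^sub>R snd z))
      + (if Some i = Some l then 1 else 0) * F i (fst z, \<theta> *\<^sub>R snd z))
      = \<theta> * D \<theta> + 1 * F l (fst z, \<theta> *\<^sub>R snd z)" for \<theta>
  proof -
    have "(\<Sum>i\<in>UNIV. (if Some i = Some l then 1 else 0) * F i (fst z, \<theta> *\<^sub>R snd z))
        = (\<Sum>i\<in>UNIV. if i = l then F i (fst z, \<theta> *\<^sub>R snd z) else 0)"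
      by (rule sum.cong) auto
    also have "\<dots> = F l (fst z, \<theta> *\<^sub>R snd z)" by simp
    finally show ?thesis
      by (simp add: sum.distrib closed[of l] D_def sum_distrib_left algebra_simps)
  qed
  with has_pd_radial[of F, OF F, where j = "Some l" and z = z] 1 show ?thesis by (simp only:)
qed

lemma Cm_decaying_numeral:
  "Cm_decaying 3 f \<Longrightarrow> Cm_decaying 2 f" "Cm_decaying 2 f \<Longrightarrow> Cm_decaying 1 f" "Cm_decaying 1 f \<Longrightarrow> Cm_decaying 0 f"
  "Cm_decaying 2 f \<Longrightarrow> Cm_decaying 1 (pd i f)" "Cm_decaying 1 f \<Longrightarrow> Cm_decaying 0 (pd i f)"
  using Cm_decaying_SucD[of _ f] Cm_decaying_pd[of _ f] by (simp_all add: eval_nat_numeral)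

lemma continuous_avg_scale:
  fixes f :: "'n::finite spacetime \<Rightarrow> real"
  assumes "continuous_on UNIV \<phi>" "continuous_on UNIV f"
  shows "continuous_on S (\<lambda>s. avg \<phi> s f z)"
proof -
  have "continuous_on S (\<lambda>s. (\<lambda>(s, z). avg \<phi> s f z) (s, z))"
    by (rule continuous_on_compose2[OF continuous_avg[OF assms, of UNIV]]) (intro continuous_intros, simp)
  then show ?thesis by simp
qed

lemma continuous_avg_point:
  fixes f :: "'n::finite spacetime \<Rightarrow> real"
  assumes "continuous_on UNIV \<phi>" "continuous_on UNIV f"
  shows "continuous_on S (avg \<phi> s f)"
proof -
  have "continuous_on S (\<lambda>z. (\<lambda>(s, z). avg \<phi> s f z) (s, z))"
    by (rule continuous_on_compose2[OF continuous_avg[OF assms, of UNIV]]) (intro continuous_intros, simp)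
  then show ?thesis by simp
qed

lemma regular_opD1: "regular_op T \<Longrightarrow> Cm_decaying m f \<Longrightarrow> Cm_on m UNIV (T f)"
  unfolding regular_op_def by blast

lemma regular_opD2: "regular_op T \<Longrightarrow> Cm_decaying 1 f \<Longrightarrow> pd None (T f) = T (pd None f)"
  unfolding regular_op_def by blast

lemma regular_radial:
  assumes reg: "\<And>i. regular_op (T i)"
    and closed: "\<And>f i l. Cm_decaying 1 f \<Longrightarrow> pd (Some l) (T i f) = pd (Some i) (T l f)"
  shows "regular_op (\<lambda>f. radial_primitive (\<lambda>i. T i f))"
    and "Cm_decaying 1 f \<Longrightarrow> pd (Some l) (radial_primitive (\<lambda>i. T i f)) = T l f"
proof -
  have space: "has_pd (radial_primitive (\<lambda>i. T i f)) (T l f z) (Some l) z" if "Cm_decaying 1 f" for f l z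
    by (rule has_pd_radial_space[OF regular_opD1[OF reg that] closed[OF that]])
  then show "Cm_decaying 1 f \<Longrightarrow> pd (Some l) (radial_primitive (\<lambda>i. T i f)) = T l f"
    using pd_eq by blast
  show "regular_op (\<lambda>f. radial_primitive (\<lambda>i. T i f))"
  proof (rule regular_opI[where S = T])
    show "continuous_on UNIV (radial_primitive (\<lambda>i. T i f))" if "Cm_decaying 0 f" for f
      using regular_opD1[OF reg that] by (intro continuous_radial) simp
    show "has_pd (radial_primitive (\<lambda>i. T i f)) (radial_primitive (\<lambda>i. T i (pd None f)) z) None z" if "Cm_decaying 1 f" for f z
      using has_pd_radial_time[OF regular_opD1[OF reg that]] by (simp add: regular_opD2[OF reg that])
    show "Cm_on m UNIV (T l f)" if "Cm_decaying (Suc m) f" for m f l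
      by (rule regular_opD1[OF reg Cm_decaying_SucD[OF that]])
  qed (rule space)
qed

section \<open>The contribution of the large scales\<close>

abbreviation bump_d3 :: "'n::finite \<Rightarrow> 'n \<Rightarrow> 'n \<Rightarrow> 'n spacetime \<Rightarrow> real" where
  "bump_d3 i j k \<equiv> pd (Some i) (pd (Some j) (pd (Some k) bump))"

lemma kernel_numeral:
  "space_kernel 4 \<phi> \<Longrightarrow> space_kernel 3 \<phi>" "space_kernel 3 \<phi> \<Longrightarrow> space_kernel 2 \<phi>"
  "space_kernel 4 \<phi> \<Longrightarrow> space_kernel 3 (pd i \<phi>)" "space_kernel 3 \<phi> \<Longrightarrow> space_kernel 2 (pd i \<phi>)"
  "space_kernel 2 \<phi> \<Longrightarrow> space_kernel 1 (pd i \<phi>)"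
  using kernel_SucD[of _ \<phi>] kernel_pd[of _ \<phi>] by (simp_all add: eval_nat_numeral)

lemma kernel_bump_d1: "space_kernel 3 (pd (Some k) bump)"
  by (rule kernel_numeral(3)[OF kernel_bump])

lemma kernel_bump_d2: "space_kernel 2 (pd (Some j) (pd (Some k) bump))"
  by (rule kernel_numeral(4)[OF kernel_bump_d1])

lemma kernel_bump_d3: "space_kernel 1 (bump_d3 i j k)"
  by (rule kernel_numeral(5)[OF kernel_bump_d2])

lemma kernel_pd_commute: "space_kernel 2 \<phi> \<Longrightarrow> pd i (pd j \<phi>) = pd j (pd i \<phi>)"
  unfolding space_kernel_def using pd_commute[of UNIV \<phi>] by blast

lemma bump_d3_commute: "bump_d3 i j k = bump_d3 j i k" "bump_d3 i j k = bump_d3 i k j"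
proof -
  show "bump_d3 i j k = bump_d3 j i k" by (rule kernel_pd_commute[OF kernel_numeral(2)[OF kernel_bump_d1]])
  have "space_kernel 2 (bump :: 'a spacetime \<Rightarrow> real)"
    by (rule kernel_numeral(2)[OF kernel_numeral(1)[OF kernel_bump]])
  then show "bump_d3 i j k = bump_d3 i k j" using kernel_pd_commute by metis
qed

text \<open>Integrating by parts gives a kernel differentiated in both directions \<open>i\<close> and \<open>l\<close>, and these derivatives commute.
  It makes the one-forms integrated below closed.\<close>

lemma far_avg_swap:
  assumes \<phi>: "space_kernel 2 \<phi>" and f: "Cm_on 1 UNIV f" and r: "r \<ge> 0"
  shows "far_avg (pd (Some i) \<phi>) (pd (Some l) f) r z = far_avg (pd (Some l) \<phi>) (pd (Some i) f) r z"
proof (cases "r = 0")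
  case False
  then have s: "1 / r > 0" using r by simp
  have k: "space_kernel (Suc 0) (pd (Some i) \<phi>)" for i
    using kernel_numeral(5)[OF \<phi>] by simp
  show ?thesis
    using avg_by_parts[OF k[of i] f s, of l z] avg_by_parts[OF k[of l] f s, of i z] False
    by (simp add: far_avg_def kernel_pd_commute[OF \<phi>, of "Some l"])
qed (simp add: far_avg_def)

lemma far_integral_cong:
  assumes "\<And>r. 0 \<le> r \<Longrightarrow> far_avg \<phi> f r z = far_avg \<psi> g r z"
  shows "far_integral \<phi> f z = far_integral \<psi> g z"
proof -
  have "integral (cbox 0 1) (\<lambda>r. far_avg \<phi> f r z) = integral (cbox 0 1) (\<lambda>r. far_avg \<psi> g r z)"
    by (rule integral_cong) (simp add: assms)
  then show ?thesis by (simp add: far_integral_def)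
qed

lemma pd_far_integral: "space_kernel m \<psi> \<Longrightarrow> Cm_decaying 1 f \<Longrightarrow> pd i (far_integral \<psi> f) = far_integral \<psi> (pd i f)"
  using pd_eq[OF has_pd_far_integral[OF kernel_continuous]] by blast

lemma far_integral_closed:
  assumes "Cm_decaying 1 f"
  shows "pd (Some l) (far_integral (bump_d3 i j k) f) = pd (Some i) (far_integral (bump_d3 l j k) f)"
  unfolding pd_far_integral[OF kernel_bump_d3 assms]
  by (rule ext, rule far_integral_cong, rule far_avg_swap[OF kernel_bump_d2 Cm_decaying_Cm[OF assms]])

text \<open>Second derivatives, gradient and value of the renormalised potential of the scales \<open>s \<ge> 1\<close>. Each level is
  the radial primitive of the level above, starting from the convergent integrals of third derivatives.\<close>

definition tail_hessian :: "'n::finite \<Rightarrow> 'n \<Rightarrow> ('n spacetime \<Rightarrow> real) \<Rightarrow> 'n spacetime \<Rightarrow> real" where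
  "tail_hessian j k f = radial_primitive (\<lambda>i. far_integral (bump_d3 i j k) f)"

definition tail_gradient :: "'n::finite \<Rightarrow> ('n spacetime \<Rightarrow> real) \<Rightarrow> 'n spacetime \<Rightarrow> real" where
  "tail_gradient k f = radial_primitive (\<lambda>j. tail_hessian j k f)"

definition tail_potential :: "('n::finite spacetime \<Rightarrow> real) \<Rightarrow> 'n spacetime \<Rightarrow> real" where
  "tail_potential f = radial_primitive (\<lambda>k. tail_gradient k f)"

lemma regular_tail_hessian: "regular_op (tail_hessian j k)"
  and pd_tail_hessian: "Cm_decaying 1 f \<Longrightarrow> pd (Some i) (tail_hessian j k f) = far_integral (bump_d3 i j k) f"
  unfolding tail_hessian_def[abs_def]
  using regular_radial[OF regular_far_integral[OF kernel_continuous[OF kernel_bump_d3]] far_integral_closed] by blast+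

lemma tail_hessian_commute: "tail_hessian j k = tail_hessian k j"
  unfolding tail_hessian_def[abs_def] by (simp add: bump_d3_commute(2))

lemma regular_tail_gradient: "regular_op (tail_gradient k)"
  and pd_tail_gradient: "Cm_decaying 1 f \<Longrightarrow> pd (Some j) (tail_gradient k f) = tail_hessian j k f"
proof -
  have c: "pd (Some l) (tail_hessian i k f) = pd (Some i) (tail_hessian l k f)" if "Cm_decaying 1 f" for f i l
    by (simp add: pd_tail_hessian[OF that] bump_d3_commute(1))
  show "regular_op (tail_gradient k)" "Cm_decaying 1 f \<Longrightarrow> pd (Some j) (tail_gradient k f) = tail_hessian j k f"
    unfolding tail_gradient_def[abs_def] using regular_radial[OF regular_tail_hessian c] by blast+
qed

lemma regular_tail_potential: "regular_op tail_potential"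
  and pd_tail_potential: "Cm_decaying 1 f \<Longrightarrow> pd (Some k) (tail_potential f) = tail_gradient k f"
proof -
  have c: "pd (Some l) (tail_gradient i f) = pd (Some i) (tail_gradient l f)" if "Cm_decaying 1 f" for f i l
    by (simp add: pd_tail_gradient[OF that] tail_hessian_commute[of l])
  show "regular_op (tail_potential :: ('a spacetime \<Rightarrow> real) \<Rightarrow> _)" "Cm_decaying 1 f \<Longrightarrow> pd (Some k) (tail_potential f) = tail_gradient k f"
    unfolding tail_potential_def[abs_def] using regular_radial[OF regular_tail_gradient c] by blast+
qed

lemma radial_sum:
  assumes "\<And>k i. continuous_on UNIV (F k i)"
  shows "(\<Sum>k\<in>K. radial_primitive (F k) z) = radial_primitive (\<lambda>i z. \<Sum>k\<in>K. F k i z) z"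
proof (cases "finite K")
  case True
  have "(\<Sum>k\<in>K. radial_primitive (F k) z) = integral (cbox 0 1) (\<lambda>\<theta>. \<Sum>k\<in>K. \<Sum>i\<in>UNIV. coord (Some i) z * F k i (fst z, \<theta> *\<^sub>R snd z))"
    unfolding radial_primitive_def
    by (rule integral_sum[OF True, symmetric], rule integrable_param[OF continuous_radial_integrand[OF assms, where T = UNIV]]) simp
  also have "\<dots> = radial_primitive (\<lambda>i z. \<Sum>k\<in>K. F k i z) z"
    unfolding radial_primitive_def by (subst sum.swap) (simp add: sum_distrib_left)
  finally show ?thesis .
qed (simp add: radial_primitive_def)

lemma far_integral_sum:
  assumes "\<And>k. continuous_on UNIV (\<phi> k)" "\<And>k. Cm_decaying 0 (f k)" "finite K"
  shows "(\<Sum>k\<in>K. far_integral (\<phi> k) (f k) z) = - integral (cbox 0 1) (\<lambda>r. \<Sum>k\<in>K. far_avg (\<phi> k) (f k) r z)"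
proof -
  have "integral (cbox 0 1) (\<lambda>r. \<Sum>k\<in>K. far_avg (\<phi> k) (f k) r z) = (\<Sum>k\<in>K. integral (cbox 0 1) (\<lambda>r. far_avg (\<phi> k) (f k) r z))"
    by (rule integral_sum[OF assms(3)], rule integrable_param[OF continuous_far_avg[OF assms(1) Cm_decaying_continuous[OF assms(2)] Cm_decaying_vanishes[OF assms(2)]]]) simp
  then show ?thesis by (simp add: far_integral_def sum_negf)
qed

section \<open>Laplacian and divergence of the potentials\<close>

text \<open>The relation \<open>\<nabla>bump = - x mass_kernel\<close> turns a change of scale of one average into a
  divergence of the other. Both Laplacians below are integrals of this derivative over scales.\<close>

lemma mass_scale_derivative:
  assumes "Cm_on 1 UNIV g"
  shows "((\<lambda>s. avg mass_kernel s g z) has_vector_derivative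
    - (\<Sum>l\<in>UNIV. avg (pd (Some l) bump) s (pd (Some l) g) z)) (at s)"
proof -
  have "avg (pd (Some l) bump) s f z = - avg (\<lambda>y. coord (Some l) y * mass_kernel y) s f z" for l f
    by (simp add: avg_def pd_bump)
  then show ?thesis
    using avg_scale_derivative[OF kernel_continuous[OF kernel_mass] assms, of z s]
    by (simp add: sum_negf)
qed

lemma pd_near: "Cm_on 1 UNIV f \<Longrightarrow> pd i (near_potential f) = near_potential (pd i f)"
  using pd_eq[OF has_pd_near] by blast

text \<open>The Laplacian of the integrand is \<open>d/ds\<close> of the average with \<open>mass_kernel\<close>, so only the scales \<open>0\<close> and \<open>1\<close> contribute.\<close>

lemma lap_near:
  fixes f :: "'n::finite spacetime \<Rightarrow> real"
  assumes f: "Cm_on 2 UNIV f"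
  shows "lap (near_potential f) z = avg mass_kernel 1 f z - mass TYPE('n) * f z"
proof -
  note f1 = Cm_numeral(3)[OF f] and f2 = Cm_numeral(6)[OF f]
  let ?D = "\<lambda>s. \<Sum>l\<in>UNIV. s * avg bump s (pd (Some l) (pd (Some l) f)) z"
  have "((\<lambda>s. avg mass_kernel s f z) has_vector_derivative ?D s) (at s)" if "s \<in> {0<..<1}" for s
  proof -
    have "space_kernel (Suc 3) bump" using kernel_bump by (simp add: eval_nat_numeral)
    from avg_by_parts[OF this f2] that
    have "- (\<Sum>l\<in>UNIV. avg (pd (Some l) bump) s (pd (Some l) f) z) = ?D s"
      by (simp add: sum_negf)
    then show ?thesis using mass_scale_derivative[OF f1, of z s] by simp
  qed
  moreover have "continuous_on {0..1} (\<lambda>s. avg mass_kernel s f z)"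
    by (rule continuous_avg_scale[OF kernel_continuous[OF kernel_mass] Cm_continuous[OF f]])
  ultimately have "(?D has_integral (avg mass_kernel 1 f z - avg mass_kernel 0 f z)) {0..1}"
    by (intro fundamental_theorem_of_calculus_interior) auto
  then have "integral (cbox 0 1) ?D = avg mass_kernel 1 f z - mass TYPE('n) * f z"
    by (simp add: integral_unique avg_mass_0)
  moreover have "lap (near_potential f) z = (\<Sum>l\<in>UNIV. near_potential (pd (Some l) (pd (Some l) f)) z)"
    by (simp add: lap_def pd_near[OF f1] pd_near[OF f2])
  moreover have "\<dots> = integral (cbox 0 1) ?D"
  proof -
    have "continuous_on (cbox 0 1 \<times> UNIV) (\<lambda>(s, z). s * avg bump s (pd (Some l) (pd (Some l) f)) z)" for l
      using f2[of "Some l"] by (intro continuous_near_integrand Cm_continuous[OF Cm_pd[of 0]]) simp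
    from integrable_param[OF this] show ?thesis
      unfolding near_potential_def by (intro integral_sum[symmetric]) simp_all
  qed
  ultimately show ?thesis by simp
qed

text \<open>Two integrations by parts identify the summed averages with \<open>d/dr\<close> of an average at scale \<open>1 / r\<close>. The end
  point \<open>r = 0\<close> contributes nothing because the data vanish at infinity.\<close>

lemma sum_far_integral_laplacian:
  assumes f: "Cm_decaying 2 f"
  shows "(\<Sum>l\<in>UNIV. far_integral (bump_d3 i l l) f z) = - avg mass_kernel 1 (pd (Some i) f) z"
proof -
  note f1 = Cm_decaying_numeral(2)[OF f] note f0 = Cm_decaying_numeral(3)[OF f1]
  define g where "g = pd (Some i) f"
  have g: "Cm_decaying 1 g" unfolding g_def by (rule Cm_decaying_numeral(4)[OF f])
  let ?D = "\<lambda>r. \<Sum>l\<in>UNIV. far_avg (bump_d3 i l l) f r z"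
  have "((\<lambda>r. far_avg mass_kernel g r z) has_vector_derivative ?D r) (at r)" if r: "r \<in> {0<..<1}" for r
  proof -
    define s where "s = 1 / r"
    have s: "s > 0" using r by (simp add: s_def)
    have "far_avg (bump_d3 i l l) f r z = s\<^sup>2 * avg (pd (Some l) bump) s (pd (Some l) g) z" for l
    proof -
      have "far_avg (bump_d3 i l l) f r z = avg (bump_d3 i l l) s f z" using r by (simp add: far_avg_def s_def)
      also have "\<dots> = - s * avg (pd (Some l) (pd (Some l) bump)) s g z"
        unfolding g_def using kernel_bump_d2 by (intro avg_by_parts[of 1] Cm_decaying_Cm[OF f1] s) (simp add: eval_nat_numeral)
      also have "avg (pd (Some l) (pd (Some l) bump)) s g z = - s * avg (pd (Some l) bump) s (pd (Some l) g) z"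
        using kernel_bump_d1 by (intro avg_by_parts[of 2] Cm_decaying_Cm[OF g] s) (simp add: eval_nat_numeral)
      finally show ?thesis by (simp add: power2_eq_square)
    qed
    then have D: "?D r = - s\<^sup>2 * - (\<Sum>l\<in>UNIV. avg (pd (Some l) bump) s (pd (Some l) g) z)"
      by (simp add: sum_distrib_left sum_negf)
    have "((\<lambda>r. 1 / r) has_vector_derivative - s\<^sup>2) (at r)"
      using r unfolding s_def has_real_derivative_iff_has_vector_derivative[symmetric]
      by (auto intro!: derivative_eq_intros simp: power2_eq_square)
    from vector_diff_chain_at[OF this mass_scale_derivative[OF Cm_decaying_Cm[OF g], of z "1 / r"]]
    have "((\<lambda>r. avg mass_kernel (1 / r) g z) has_vector_derivative ?D r) (at r)"
      by (simp add: o_def D s_def)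
    then show ?thesis
      by (rule has_vector_derivative_transform_within_open[of _ _ _ "{0<..}"]) (use r in \<open>auto simp: far_avg_def\<close>)
  qed
  moreover have "continuous_on {0..1} (\<lambda>r. far_avg mass_kernel g r z)"
  proof -
    have "continuous_on {0..1} (\<lambda>r. (\<lambda>(r, z). far_avg mass_kernel g r z) (r, z))"
      by (rule continuous_on_compose2[OF continuous_far_avg[OF kernel_continuous[OF kernel_mass]
        Cm_decaying_continuous[OF g] Cm_decaying_vanishes[OF g]]]) (intro continuous_intros, auto)
    then show ?thesis by simp
  qed
  ultimately have "(?D has_integral (far_avg mass_kernel g 1 z - far_avg mass_kernel g 0 z)) {0..1}"
    by (intro fundamental_theorem_of_calculus_interior) auto
  then have "integral (cbox 0 1) ?D = avg mass_kernel 1 g z"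
    by (simp add: integral_unique far_avg_def)
  moreover have "(\<Sum>l\<in>UNIV. far_integral (bump_d3 i l l) f z) = - integral (cbox 0 1) ?D"
    by (rule far_integral_sum[OF kernel_continuous[OF kernel_bump_d3] f0 finite])
  ultimately show ?thesis by (simp only: g_def)
qed

text \<open>Two derivatives undo two of the three radial primitives, so the Laplacian is the radial primitive of the one-form
  in \<open>sum_far_integral_laplacian\<close>, which is a gradient. The normalisation at \<open>x = 0\<close> produces the first term on the right.\<close>

lemma lap_tail_potential:
  assumes f: "Cm_decaying 2 f"
  shows "lap (tail_potential f) z = avg mass_kernel 1 f (fst z, 0) - avg mass_kernel 1 f z"
proof -
  note f1 = Cm_decaying_numeral(2)[OF f] note f0 = Cm_decaying_numeral(3)[OF f1]
  define g where "g = (\<lambda>z. - avg mass_kernel 1 f z)"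
  have avg1: "has_pd (avg mass_kernel 1 h) (avg mass_kernel 1 (pd i h) z) i z" if "Cm_decaying 1 h" for h i z
    by (rule has_pd_avg[OF kernel_continuous[OF kernel_mass] Cm_decaying_Cm[OF that]])
  have pg: "has_pd g (- avg mass_kernel 1 (pd i f) z) i z" for i z
    using has_pd_diff[OF has_pd_const[of 0] avg1[OF f1]] by (simp add: g_def)
  have cavg: "continuous_on UNIV (avg mass_kernel 1 h)" if "continuous_on UNIV h" for h
    by (rule continuous_avg_point[OF kernel_continuous[OF kernel_mass] that])
  have "Cm_on (Suc 0) UNIV g"
  proof (rule Cm_SucI[OF pg])
    show "Cm_on 0 UNIV (\<lambda>z. - avg mass_kernel 1 (pd i f) z)" for i
      using cavg[OF Cm_decaying_continuous[OF Cm_decaying_numeral(5)[OF f1]]] by (simp add: continuous_on_minus)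
  qed
  then have g: "Cm_on 1 UNIV g" by simp
  have "lap (tail_potential f) z = (\<Sum>l\<in>UNIV. tail_hessian l l f z)"
    by (simp add: lap_def pd_tail_potential[OF f1] pd_tail_gradient[OF f1])
  also have "\<dots> = radial_primitive (\<lambda>i z. \<Sum>l\<in>UNIV. far_integral (bump_d3 i l l) f z) z"
    unfolding tail_hessian_def by (rule radial_sum) (rule continuous_far_integral[OF kernel_continuous[OF kernel_bump_d3] f0])
  also have "\<dots> = radial_primitive (\<lambda>i. pd (Some i) g) z"
    by (rule arg_cong[where f = "\<lambda>F. radial_primitive F z"], intro ext)
      (simp add: pd_eq[OF pg] sum_far_integral_laplacian[OF f])
  also have "\<dots> = g z - g (fst z, 0)" by (rule radial_gradient[OF g])
  finally show ?thesis by (simp add: g_def)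
qed

text \<open>Under the integral over scales a derivative of the kernel becomes a derivative of \<open>a\<close>, so the divergence vanishes at
  the level of third derivatives, and radial primitives of \<open>0\<close> are \<open>0\<close>.\<close>

lemma div_tail_potential:
  fixes a :: "'n::finite \<Rightarrow> 'n spacetime \<Rightarrow> real"
  assumes a: "\<And>k. Cm_decaying 1 (a k)" and div: "\<And>z. (\<Sum>k\<in>UNIV. pd (Some k) (a k) z) = 0"
  shows "(\<Sum>k\<in>UNIV. pd (Some k) (tail_potential (a k)) z) = 0"
proof -
  have a0: "Cm_decaying 0 (a k)" for k by (rule Cm_decaying_numeral(3)[OF a])
  have 0: "(\<Sum>k\<in>UNIV. far_avg (bump_d3 k i j) (a k) r z) = 0" if r: "r \<in> cbox 0 1" for r i j z
  proof (cases "r = 0")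
    case False
    define s where "s = 1 / r"
    have s: "s > 0" using r False by (simp add: s_def)
    have k2: "space_kernel (Suc 1) (pd (Some i) (pd (Some j) bump))" using kernel_bump_d2 by (simp add: eval_nat_numeral)
    have cont: "continuous_on UNIV (pd (Some k) (a k))" for k
      by (rule Cm_decaying_continuous[OF Cm_decaying_numeral(5)[OF a]])
    have "(\<Sum>k\<in>UNIV. far_avg (bump_d3 k i j) (a k) r z) = (\<Sum>k\<in>UNIV. - s * avg (pd (Some i) (pd (Some j) bump)) s (pd (Some k) (a k)) z)"
      using avg_by_parts[OF k2 Cm_decaying_Cm[OF a] s] False by (simp add: far_avg_def s_def)
    also have "\<dots> = - s * integral Qbox (\<lambda>y. \<Sum>k\<in>UNIV. pd (Some i) (pd (Some j) bump) (0, y) * pd (Some k) (a k) (z + (0, s *\<^sub>R y)))"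
    proof -
      have "integral Qbox (\<lambda>y. \<Sum>k\<in>UNIV. pd (Some i) (pd (Some j) bump) (0, y) * pd (Some k) (a k) (z + (0, s *\<^sub>R y)))
        = (\<Sum>k\<in>UNIV. avg (pd (Some i) (pd (Some j) bump)) s (pd (Some k) (a k)) z)"
        unfolding avg_def
        by (rule integral_sum) (simp_all only: finite avg_integrable[OF kernel_continuous[OF kernel_bump_d2] cont])
      then show ?thesis by (simp only: sum_distrib_left)
    qed
    also have "\<dots> = 0" by (simp add: sum_distrib_left[symmetric] div)
    finally show ?thesis .
  qed (simp add: far_avg_def)
  have T: "(\<Sum>k\<in>UNIV. far_integral (bump_d3 k i j) (a k) z) = 0" for i j z
  proof -
    have "(\<Sum>k\<in>UNIV. far_integral (bump_d3 k i j) (a k) z) = - integral (cbox 0 1) (\<lambda>r. \<Sum>k\<in>UNIV. far_avg (bump_d3 k i j) (a k) r z)"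
      by (rule far_integral_sum[OF kernel_continuous[OF kernel_bump_d3] a0 finite])
    also have "integral (cbox 0 1) (\<lambda>r. \<Sum>k\<in>UNIV. far_avg (bump_d3 k i j) (a k) r z) = integral (cbox 0 1) (\<lambda>r::real. 0)"
      by (rule integral_cong) (rule 0)
    finally show ?thesis by simp
  qed
  have "(\<Sum>k\<in>UNIV. pd (Some k) (tail_potential (a k)) z) = (\<Sum>k\<in>UNIV. radial_primitive (\<lambda>j. tail_hessian j k (a k)) z)"
    by (simp add: pd_tail_potential[OF a] tail_gradient_def)
  also have "\<dots> = radial_primitive (\<lambda>j z. \<Sum>k\<in>UNIV. tail_hessian j k (a k) z) z"
    using regular_opD1[OF regular_tail_hessian a0] by (intro radial_sum) simp
  also have "(\<lambda>j z. \<Sum>k\<in>UNIV. tail_hessian j k (a k) z) = (\<lambda>j. radial_primitive (\<lambda>i z. \<Sum>k\<in>UNIV. far_integral (bump_d3 i j k) (a k) z))"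
    unfolding tail_hessian_def by (intro ext radial_sum) (rule continuous_far_integral[OF kernel_continuous[OF kernel_bump_d3] a0])
  also have "\<dots> = (\<lambda>j z. 0)"
    using T by (simp add: bump_d3_commute(2)[of _ _ k for k] bump_d3_commute(1)[of _ k for k] radial_primitive_def[abs_def])
  finally show ?thesis by (simp add: radial_primitive_def)
qed

section \<open>A closed two-form with prescribed divergence\<close>

lemma pd_diff: "Cm_on 1 UNIV f \<Longrightarrow> Cm_on 1 UNIV g \<Longrightarrow> pd i (\<lambda>z. f z - g z) = (\<lambda>z. pd i f z - pd i g z)"
  by (rule ext, rule pd_eq, rule has_pd_diff; rule Cm_has_pd_UNIV[of 0]; simp)

lemma pd_add: "Cm_on 1 UNIV f \<Longrightarrow> Cm_on 1 UNIV g \<Longrightarrow> pd i (\<lambda>z. f z + g z) = (\<lambda>z. pd i f z + pd i g z)"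
  by (rule ext, rule pd_eq, rule has_pd_add; rule Cm_has_pd_UNIV[of 0]; simp)

lemma pd_sum: "(\<And>k. k \<in> I \<Longrightarrow> Cm_on 1 UNIV (f k)) \<Longrightarrow> pd i (\<lambda>z. \<Sum>k\<in>I. f k z) = (\<lambda>z. \<Sum>k\<in>I. pd i (f k) z)"
  by (rule ext, rule pd_eq, rule has_pd_sum; rule Cm_has_pd_UNIV[of 0]; simp)

lemma pd_cmult:
  fixes f :: "'n::finite spacetime \<Rightarrow> 'b::real_normed_algebra"
  shows "Cm_on 1 UNIV f \<Longrightarrow> pd i (\<lambda>z. c * f z) = (\<lambda>z. c * pd i f z)"
  by (rule ext, rule pd_eq, rule has_pd_cmult; rule Cm_has_pd_UNIV[of 0]; simp)

lemma lap_add: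
  assumes "Cm_on 2 UNIV f" "Cm_on 2 UNIV g"
  shows "lap (\<lambda>z. f z + g z) z = lap f z + lap g z"
  unfolding lap_def pd_add[OF assms[THEN Cm_numeral(3)]] pd_add[OF assms[THEN Cm_numeral(6)]]
  by (rule sum.distrib)

lemma lap_cmult:
  fixes f :: "'n::finite spacetime \<Rightarrow> 'b::real_normed_algebra"
  assumes "Cm_on 2 UNIV f"
  shows "lap (\<lambda>z. c * f z) z = c * lap f z"
  unfolding lap_def pd_cmult[OF assms[THEN Cm_numeral(3)]] pd_cmult[OF assms[THEN Cm_numeral(6)]]
  by (rule sum_distrib_left[symmetric])

lemma lap_diff:
  assumes "Cm_on 2 UNIV f" "Cm_on 2 UNIV g"
  shows "lap (\<lambda>z. f z - g z) z = lap f z - lap g z"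
  unfolding lap_def pd_diff[OF assms[THEN Cm_numeral(3)]] pd_diff[OF assms[THEN Cm_numeral(6)]]
  by (rule sum_subtractf)

definition renormalised_potential :: "('n::finite spacetime \<Rightarrow> real) \<Rightarrow> 'n spacetime \<Rightarrow> real" where
  "renormalised_potential f z = - (1 / mass TYPE('n)) * (near_potential f z + tail_potential f z)"

text \<open>The function of time by which the renormalised potential fails to solve the Poisson equation.\<close>

definition origin_mean :: "('n::finite spacetime \<Rightarrow> real) \<Rightarrow> 'n spacetime \<Rightarrow> real" where
  "origin_mean f z = 1 / mass TYPE('n) * avg mass_kernel 1 f (fst z, 0)"

lemma Cm_avg: "space_kernel k \<phi> \<Longrightarrow> Cm_on m UNIV f \<Longrightarrow> Cm_on m UNIV (avg \<phi> s f)"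
proof (induction m arbitrary: f)
  case 0 then show ?case by (simp add: continuous_avg_point kernel_continuous)
next
  case (Suc m)
  have "Cm_on 1 UNIV f" by (rule Cm_mono[OF Suc.prems(2)]) simp
  then show ?case
    by (intro Cm_SucI[where g = "\<lambda>i. avg \<phi> s (pd i f)"] has_pd_avg kernel_continuous[OF Suc.prems(1)]
        Suc.IH[OF Suc.prems(1)] Cm_pd[OF Suc.prems(2)])
qed

lemma has_pd_at_origin:
  fixes g :: "'n::finite spacetime \<Rightarrow> 'b::real_normed_algebra_1"
  assumes "Cm_on 1 UNIV g"
  shows "has_pd (\<lambda>z :: 'n spacetime. g (fst z, 0)) ((if i = None then 1 else 0) *\<^sub>R pd i g (fst z, 0)) i z"
  using has_pd_dilate[of g "pd i g (fst z, 0)" i z 0] Cm_has_pd_UNIV[of 0 g i] assms by simp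

lemma Cm_at_origin:
  fixes g :: "'n::finite spacetime \<Rightarrow> 'b::real_normed_algebra_1"
  shows "Cm_on m UNIV g \<Longrightarrow> Cm_on m UNIV (\<lambda>z :: 'n spacetime. g (fst z, 0))"
proof (induction m arbitrary: g)
  case 0
  then have "continuous_on UNIV g" by simp
  then have "continuous_on UNIV (\<lambda>z :: 'n spacetime. g (fst z, 0))"
    by (rule continuous_on_compose2) (intro continuous_intros, simp)
  then show ?case by simp
next
  case (Suc m)
  have 1: "Cm_on 1 UNIV g" by (rule Cm_mono[OF Suc.prems]) simp
  show ?case
    by (rule Cm_SucI[where g = "\<lambda>i z. (if i = None then 1 else 0) *\<^sub>R pd i g (fst z, 0)"],
        rule has_pd_at_origin[OF 1]) (intro Cm_linear[OF bounded_linear_scaleR_right] Suc.IH[OF Cm_pd[OF Suc.prems]])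
qed

lemma Cm_origin_mean: "Cm_on m UNIV f \<Longrightarrow> Cm_on m UNIV (origin_mean f)"
  unfolding origin_mean_def[abs_def] by (intro Cm_cmult Cm_at_origin Cm_avg[OF kernel_mass])

lemma has_pd_origin_mean:
  assumes "Cm_on 1 UNIV f" shows "has_pd (origin_mean f) 0 (Some l) z"
proof -
  have "has_pd (\<lambda>z. 1 / mass TYPE('a) * avg mass_kernel 1 f (fst z, 0)) (1 / mass TYPE('a) *
      ((if Some l = None then 1 else 0) *\<^sub>R pd (Some l) (avg mass_kernel 1 f) (fst z, 0))) (Some l) z"
    by (rule has_pd_cmult[OF has_pd_at_origin[OF Cm_avg[OF kernel_mass assms]]])
  then show ?thesis by (simp add: origin_mean_def[abs_def])
qed

lemma Cm_renormalised_potential: "Cm_decaying m f \<Longrightarrow> Cm_on m UNIV (renormalised_potential f)"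
  unfolding renormalised_potential_def[abs_def]
  by (intro Cm_cmult Cm_add regular_opD1[OF regular_near] regular_opD1[OF regular_tail_potential])

lemma lap_renormalised_potential:
  fixes f :: "'n::finite spacetime \<Rightarrow> real"
  assumes f: "Cm_decaying 2 f"
  shows "lap (renormalised_potential f) z = f z - origin_mean f z"
proof -
  note n = regular_opD1[OF regular_near f] and e = regular_opD1[OF regular_tail_potential f]
  have "lap (renormalised_potential f) z = - (1 / mass TYPE('n)) * (lap (near_potential f) z + lap (tail_potential f) z)"
    unfolding renormalised_potential_def[abs_def] by (simp only: lap_cmult[OF Cm_add[OF n e]] lap_add[OF n e])
  also have "\<dots> = f z - origin_mean f z"
    using mass_nonzero[where 'n = 'n]
    by (simp add: lap_near[OF Cm_decaying_Cm[OF f]] lap_tail_potential[OF f] origin_mean_def field_simps)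
  finally show ?thesis .
qed

lemma div_near:
  assumes a: "\<And>k. Cm_on 1 UNIV (a k)" and div: "\<And>z. (\<Sum>k\<in>UNIV. pd (Some k) (a k) z) = 0"
  shows "(\<Sum>k\<in>UNIV. pd (Some k) (near_potential (a k)) z) = 0"
proof -
  have c: "continuous_on UNIV (pd (Some k) (a k))" for k
    using Cm_continuous[OF Cm_pd[of 0 UNIV "a k" "Some k"]] a by simp
  note b = kernel_continuous[OF kernel_bump]
  have 0: "(\<Sum>k\<in>UNIV. s * avg bump s (pd (Some k) (a k)) z) = 0" for s
  proof -
    have "(\<Sum>k\<in>UNIV. avg bump s (pd (Some k) (a k)) z)
        = integral Qbox (\<lambda>y. \<Sum>k\<in>UNIV. bump (0, y) * pd (Some k) (a k) (z + (0, s *\<^sub>R y)))"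
      unfolding avg_def by (rule integral_sum[symmetric]) (simp_all only: finite avg_integrable[OF b c])
    also have "\<dots> = 0" by (simp add: sum_distrib_left[symmetric] div)
    finally show ?thesis by (simp add: sum_distrib_left[symmetric])
  qed
  have "(\<Sum>k\<in>UNIV. pd (Some k) (near_potential (a k)) z) = integral (cbox 0 1) (\<lambda>s. \<Sum>k\<in>UNIV. s * avg bump s (pd (Some k) (a k)) z)"
    unfolding pd_near[OF a] near_potential_def
    by (rule integral_sum[symmetric], simp,
        rule integrable_param[OF continuous_near_integrand[OF c, where S = "_ \<times> UNIV"]], simp)
  then show ?thesis by (simp add: 0)
qed

text \<open>A polynomial with Laplacian \<open>1\<close> that does not depend on \<open>x\<^sub>k\<close>, so that adding a multiple of it to
  the component \<open>k\<close> of a potential does not change the divergence. For a spatial \<open>k\<close> in dimension one the set of remaining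
  variables is empty and the function is \<open>0\<close>.\<close>

definition quadric :: "'n::finite option \<Rightarrow> 'n spacetime \<Rightarrow> real" where
  "quadric k z = 1 / (2 * real (card {j. Some j \<noteq> k}))
     * (\<Sum>j | Some j \<noteq> k. coord (Some j) z * coord (Some j) z)"

lemma Cm_quadric: "Cm_on m UNIV (quadric k)"
  unfolding quadric_def[abs_def] by (intro Cm_cmult Cm_sum Cm_mult Cm_coord)

lemma has_pd_quadric:
  "has_pd (quadric k) ((if Some l \<noteq> k then 1 / real (card {j. Some j \<noteq> k}) else 0) * coord (Some l) z) (Some l) z"
proof -
  have "has_pd (quadric k) (1 / (2 * real (card {j. Some j \<noteq> k})) * (\<Sum>j | Some j \<noteq> k.
      coord (Some j) z * (if Some j = Some l then 1 else 0) + (if Some j = Some l then 1 else 0) * coord (Some j) z)) (Some l) z"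
    unfolding quadric_def[abs_def] by (intro has_pd_cmult has_pd_sum has_pd_mult has_pd_coord)
  moreover have "(\<Sum>j | Some j \<noteq> k.
      coord (Some j) z * (if Some j = Some l then 1 else 0) + (if Some j = Some l then 1 else 0) * coord (Some j) z)
     = (\<Sum>j | Some j \<noteq> k. if j = l then 2 * coord (Some l) z else 0)"
    by (rule sum.cong) auto
  moreover have "1 / (2 * real (card {j. Some j \<noteq> k})) * (\<Sum>j | Some j \<noteq> k. if j = l then 2 * coord (Some l) z else 0)
     = (if Some l \<noteq> k then 1 / real (card {j. Some j \<noteq> k}) else 0) * coord (Some l) z"
    by (cases "Some l = k") (simp_all add: sum.delta)
  ultimately show ?thesis by (simp only:)
qed

text \<open>In the degenerate case where \<open>quadric k\<close> is \<open>0\<close>, both sides vanish by the second premise.\<close>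

lemma lap_origin_mean_quadric:
  fixes k :: "'n::finite option"
  assumes f: "Cm_on 2 UNIV f" and ne: "{j. Some j \<noteq> k} = {} \<Longrightarrow> origin_mean f z = 0"
  shows "lap (\<lambda>z. origin_mean f z * quadric k z) z = origin_mean f z"
proof -
  define q where "q l = (if Some l \<noteq> k then 1 / real (card {j. Some j \<noteq> k}) else 0)" for l
  note f1 = Cm_numeral(3)[OF f]
  have 1: "pd (Some l) (\<lambda>z. origin_mean f z * quadric k z) = (\<lambda>z. origin_mean f z * (q l * coord (Some l) z))" for l
  proof
    fix z
    have "has_pd (\<lambda>z. origin_mean f z * quadric k z) (origin_mean f z * (q l * coord (Some l) z) + 0 * quadric k z) (Some l) z"
      unfolding q_def by (intro has_pd_mult has_pd_origin_mean[OF f1] has_pd_quadric)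
    then show "pd (Some l) (\<lambda>z. origin_mean f z * quadric k z) z = origin_mean f z * (q l * coord (Some l) z)"
      by (simp add: pd_eq)
  qed
  have 2: "pd (Some l) (\<lambda>z. origin_mean f z * (q l * coord (Some l) z)) z = origin_mean f z * q l" for l
  proof -
    have "has_pd (\<lambda>z. origin_mean f z * (q l * coord (Some l) z))
        (origin_mean f z * (q l * (if Some l = Some l then 1 else 0)) + 0 * (q l * coord (Some l) z)) (Some l) z"
      by (intro has_pd_mult[OF has_pd_origin_mean[OF f1]] has_pd_cmult has_pd_coord)
    then show ?thesis by (simp add: pd_eq)
  qed
  have "lap (\<lambda>z. origin_mean f z * quadric k z) z = origin_mean f z * (\<Sum>l\<in>UNIV. q l)"
    by (simp only: lap_def 1 2 sum_distrib_left)
  also have "(\<Sum>l\<in>UNIV. q l) = (\<Sum>l | Some l \<noteq> k. 1 / real (card {j. Some j \<noteq> k}))"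
    unfolding q_def by (subst sum.inter_filter[symmetric]) simp_all
  also have "origin_mean f z * \<dots> = origin_mean f z"
    using ne by (cases "{j. Some j \<noteq> k} = {}") (simp_all add: card_eq_0_iff)
  finally show ?thesis .
qed

text \<open>In dimension one, freedom from divergence means that the function is constant in space, and it decays.\<close>

lemma single_direction_zero:
  fixes f :: "'n::finite spacetime \<Rightarrow> real"
  assumes f: "Cm_decaying 1 f" and univ: "(UNIV :: 'n set) = {k}" and der: "\<And>z. pd (Some k) f z = 0"
  shows "f z = 0"
proof (rule ccontr)
  assume "f z \<noteq> 0"
  then obtain R where R: "\<And>t x. \<bar>t\<bar> \<le> \<bar>fst z\<bar> \<Longrightarrow> R \<le> norm x \<Longrightarrow> norm (f (t, x)) < \<bar>f z\<bar>"
    using Cm_decaying_vanishes[OF f] unfolding vanishes_at_infinity_def by (meson zero_less_abs_iff)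
  define h where "h = \<bar>R\<bar> + norm (snd z)"
  have "((\<lambda>h. f (z + h *\<^sub>R dir (Some k))) has_vector_derivative 0) (at h)" for h
    using has_pd_along_line[of f 0 "Some k" z h] Cm_has_pd_UNIV[of 0 f "Some k"] Cm_decaying_Cm[OF f] der by simp
  then have d: "\<forall>h. ((\<lambda>h. f (z + h *\<^sub>R dir (Some k))) has_real_derivative 0) (at h)"
    by (simp add: has_real_derivative_iff_has_vector_derivative)
  have "f (z + h *\<^sub>R dir (Some k)) = f (z + 0 *\<^sub>R dir (Some k))"
    by (rule DERIV_isconst_all[OF d])
  moreover have "R \<le> norm (snd (z + h *\<^sub>R dir (Some k)))"
  proof -
    have "norm (h *\<^sub>R axis k (1::real)) \<le> norm (snd z + h *\<^sub>R axis k 1) + norm (snd z)"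
      by (metis add_diff_cancel_left' norm_triangle_ineq4)
    then show ?thesis by (simp add: h_def)
  qed
  then have "norm (f (fst z, snd (z + h *\<^sub>R dir (Some k)))) < \<bar>f z\<bar>" by (intro R) simp
  moreover have "z + h *\<^sub>R dir (Some k) = (fst z, snd (z + h *\<^sub>R dir (Some k)))"
    by (simp add: prod_eq_iff)
  ultimately show False by (simp add: zero_prod_def[symmetric])
qed

lemma divergence_free_potential:
  fixes a :: "'n::finite option \<Rightarrow> 'n spacetime \<Rightarrow> real"
  assumes a: "\<And>i. Cm_decaying 3 (a i)" and div: "\<And>z. (\<Sum>k\<in>UNIV. pd (Some k) (a (Some k)) z) = 0"
  obtains \<alpha> :: "'n option \<Rightarrow> 'n spacetime \<Rightarrow> real" where
    "\<And>i. Cm_on 3 UNIV (\<alpha> i)" "\<And>i z. lap (\<alpha> i) z = a i z"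
    "\<And>z. (\<Sum>k\<in>UNIV. pd (Some k) (\<alpha> (Some k)) z) = 0"
proof
  define \<alpha> where "\<alpha> i z = renormalised_potential (a i) z + origin_mean (a i) z * quadric i z" for i z
  note a2 = Cm_decaying_numeral(1)[OF a] note a1 = Cm_decaying_numeral(2)[OF a2]
  note N = Cm_renormalised_potential[OF a] and M = Cm_mult[OF Cm_origin_mean[OF Cm_decaying_Cm[OF a]] Cm_quadric]
  show "Cm_on 3 UNIV (\<alpha> i)" for i
    unfolding \<alpha>_def[abs_def] by (intro Cm_add N M)
  show "lap (\<alpha> i) z = a i z" for i z
  proof -
    have ne: "origin_mean (a i) z = 0" if e: "{j. Some j \<noteq> i} = {}"
    proof -
      \<comment> \<open>The exceptional case is one space dimension and a spatial index.\<close>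
      obtain k where k: "i = Some k" using e by (cases i) auto
      have univ: "(UNIV :: 'n set) = {k}" using e k by auto
      have "pd (Some k) (a i) z = 0" for z using div[of z] k by (subst (asm) univ) simp
      then have "a i z = 0" for z by (rule single_direction_zero[OF a1 univ])
      then show ?thesis by (simp add: origin_mean_def avg_def)
    qed
    have "lap (\<alpha> i) z = lap (renormalised_potential (a i)) z + lap (\<lambda>z. origin_mean (a i) z * quadric i z) z"
      unfolding \<alpha>_def[abs_def] by (intro lap_add Cm_numeral(2) N M)
    then show ?thesis using lap_origin_mean_quadric[OF Cm_decaying_Cm[OF a2] ne] by (simp add: lap_renormalised_potential[OF a2])
  qed
  show "(\<Sum>k\<in>UNIV. pd (Some k) (\<alpha> (Some k)) z) = 0" for z
  proof -
    have "pd (Some k) (\<alpha> (Some k)) z = - (1 / mass TYPE('n)) *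
        (pd (Some k) (near_potential (a (Some k))) z + pd (Some k) (tail_potential (a (Some k))) z)" for k
    proof (rule pd_eq)
      have Ne: "has_pd (near_potential (a (Some k))) (pd (Some k) (near_potential (a (Some k))) z) (Some k) z"
        using regular_opD1[OF regular_near a1, of "Some k"] by (intro Cm_has_pd_UNIV[of 0]) simp
      have E: "has_pd (tail_potential (a (Some k))) (pd (Some k) (tail_potential (a (Some k))) z) (Some k) z"
        using regular_opD1[OF regular_tail_potential a1, of "Some k"] by (intro Cm_has_pd_UNIV[of 0]) simp
      have "has_pd (\<alpha> (Some k)) (- (1 / mass TYPE('n)) *
        (pd (Some k) (near_potential (a (Some k))) z + pd (Some k) (tail_potential (a (Some k))) z)
        + (origin_mean (a (Some k)) z * ((if Some k \<noteq> Some k then 1 / real (card {j. Some j \<noteq> Some k}) else 0) * coord (Some k) z)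
           + 0 * quadric (Some k) z)) (Some k) z"
        unfolding \<alpha>_def[abs_def] renormalised_potential_def[abs_def]
        by (intro has_pd_add has_pd_cmult Ne E has_pd_mult has_pd_quadric has_pd_origin_mean Cm_decaying_Cm[OF a1])
      then show "has_pd (\<alpha> (Some k)) (- (1 / mass TYPE('n)) *
        (pd (Some k) (near_potential (a (Some k))) z + pd (Some k) (tail_potential (a (Some k))) z)) (Some k) z" by simp
    qed
    then have "(\<Sum>k\<in>UNIV. pd (Some k) (\<alpha> (Some k)) z) = - (1 / mass TYPE('n)) *
       ((\<Sum>k\<in>UNIV. pd (Some k) (near_potential (a (Some k))) z) + (\<Sum>k\<in>UNIV. pd (Some k) (tail_potential (a (Some k))) z))"
      by (simp only: sum_distrib_left sum.distrib distrib_left)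
    then show ?thesis using div_near[OF Cm_decaying_Cm[OF a1] div] div_tail_potential[OF a1 div] by simp
  qed
qed

lemma pd_swap: "Cm_on 2 UNIV (f :: _ \<Rightarrow> 'b::banach) \<Longrightarrow> pd i (pd j f) = pd j (pd i f)"
  using pd_commute[of UNIV f] by blast

lemma lap_pd:
  fixes f :: "'n::finite spacetime \<Rightarrow> 'b::banach"
  assumes f: "Cm_on 3 UNIV f"
  shows "lap (pd i f) z = pd i (lap f) z"
proof -
  have "pd (Some k) (pd (Some k) (pd i f)) = pd i (pd (Some k) (pd (Some k) f))" for k
    using pd_swap[OF Cm_numeral(2)[OF f], of "Some k" i] pd_swap[OF Cm_numeral(5)[OF f], of "Some k" i "Some k"]
    by simp
  then have "lap (pd i f) z = (\<Sum>k\<in>UNIV. pd i (pd (Some k) (pd (Some k) f)) z)"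
    by (simp add: lap_def)
  also have "\<dots> = pd i (\<lambda>z. \<Sum>k\<in>UNIV. pd (Some k) (pd (Some k) f) z) z"
    by (subst pd_sum) (rule Cm_numeral(6)[OF Cm_numeral(5)[OF f]] refl)+
  finally show ?thesis by (simp add: lap_def[abs_def])
qed

text \<open>The exterior derivative of the potentials: closedness and the formula for the Laplacian come from
  commuting derivatives, and the divergence is \<open>\<Delta> \<alpha>\<^sub>k - \<partial>\<^sub>k div \<alpha> = a\<^sub>k\<close>.\<close>

lemma closed_two_form:
  fixes a :: "'n::finite option \<Rightarrow> 'n spacetime \<Rightarrow> real"
  assumes a: "\<And>i. Cm_decaying 3 (a i)" and div: "\<And>z. (\<Sum>k\<in>UNIV. pd (Some k) (a (Some k)) z) = 0"
  obtains \<kappa> :: "'n option \<Rightarrow> 'n option \<Rightarrow> 'n spacetime \<Rightarrow> real" where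
    "\<And>k j. Cm_on 2 UNIV (\<kappa> k j)"
    "\<And>k j z. \<kappa> k j z = - \<kappa> j k z"
    "\<And>k z. a k z = (\<Sum>l\<in>UNIV. pd (Some l) (\<kappa> (Some l) k) z)"
    "\<And>i j k z. pd i (\<kappa> j k) z + pd j (\<kappa> k i) z + pd k (\<kappa> i j) z = 0"
    "\<And>k j z. lap (\<kappa> k j) z = pd k (a j) z - pd j (a k) z"
proof -
  obtain \<alpha> :: "'n option \<Rightarrow> 'n spacetime \<Rightarrow> real" where
    \<alpha>: "\<And>i. Cm_on 3 UNIV (\<alpha> i)" and lap\<alpha>: "\<And>i z. lap (\<alpha> i) z = a i z"
    and div\<alpha>: "\<And>z. (\<Sum>k\<in>UNIV. pd (Some k) (\<alpha> (Some k)) z) = 0"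
    using divergence_free_potential[OF a div] by blast
  define \<kappa> where "\<kappa> l k z = pd l (\<alpha> k) z - pd k (\<alpha> l) z" for l k z
  note D2 = Cm_numeral(5)[OF \<alpha>] note D1 = Cm_numeral(3)[OF D2]
  note swap = pd_swap[OF Cm_numeral(2)[OF \<alpha>]]
  have pd\<kappa>: "pd i (\<kappa> l k) z = pd i (pd l (\<alpha> k)) z - pd i (pd k (\<alpha> l)) z" for i l k z
    unfolding \<kappa>_def[abs_def] by (simp add: pd_diff[OF D1 D1])
  show thesis
  proof
    show "Cm_on 2 UNIV (\<kappa> k j)" for k j
      unfolding \<kappa>_def[abs_def] by (intro Cm_diff D2)
    show "\<kappa> k j z = - \<kappa> j k z" for k j z by (simp add: \<kappa>_def)
    show "a k z = (\<Sum>l\<in>UNIV. pd (Some l) (\<kappa> (Some l) k) z)" for k z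
    proof -
      have "(\<Sum>l\<in>UNIV. pd (Some l) (\<kappa> (Some l) k) z)
          = lap (\<alpha> k) z - (\<Sum>l\<in>UNIV. pd k (pd (Some l) (\<alpha> (Some l))) z)"
        by (simp add: pd\<kappa> sum_subtractf lap_def swap[of "Some l" k for l])
      also have "(\<Sum>l\<in>UNIV. pd k (pd (Some l) (\<alpha> (Some l))) z) = pd k (\<lambda>z. \<Sum>l\<in>UNIV. pd (Some l) (\<alpha> (Some l)) z) z"
        by (subst pd_sum) (rule D1 refl)+
      also have "\<dots> = 0" by (simp add: div\<alpha> pd_eq[OF has_pd_const])
      finally show ?thesis by (simp add: lap\<alpha>)
    qed
    show "pd i (\<kappa> j k) z + pd j (\<kappa> k i) z + pd k (\<kappa> i j) z = 0" for i j k z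
      by (simp add: pd\<kappa> swap[of i j] swap[of k i] swap[of j k])
    show "lap (\<kappa> k j) z = pd k (a j) z - pd j (a k) z" for k j z
    proof -
      have "lap (\<kappa> k j) z = pd k (lap (\<alpha> j)) z - pd j (lap (\<alpha> k)) z"
        unfolding \<kappa>_def[abs_def] by (simp only: lap_diff[OF D2 D2] lap_pd[OF \<alpha>])
      moreover have "lap (\<alpha> i) = a i" for i using lap\<alpha> by blast
      ultimately show ?thesis by simp
    qed
  qed
qed

section \<open>Structure equations of a Schroedinger map\<close>

lemma conf_eq: "conf s z = 1 + s z * cnj (s z)"
  by (simp add: conf_def complex_norm_square[symmetric])

lemma conf_nonzero: "conf s z \<noteq> 0"
proof -
  have "1 + (cmod (s z))\<^sup>2 > 0" by (simp add: add_pos_nonneg)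
  then show ?thesis unfolding conf_def by (metis of_real_eq_0_iff less_irrefl)
qed

lemma has_pd_conf:
  assumes "has_pd s d i z"
  shows "has_pd (conf s) (s z * cnj d + d * cnj (s z)) i z"
proof -
  have "has_pd (\<lambda>z. 1 + s z * cnj (s z)) (0 + (s z * cnj d + d * cnj (s z))) i z"
    by (intro has_pd_add has_pd_const has_pd_mult has_pd_cnj assms)
  then show ?thesis by (simp add: conf_eq[abs_def])
qed

lemma has_pd_phase:
  assumes "has_pd \<psi> d i z"
  shows "has_pd (\<lambda>y. exp (- \<i> * of_real (\<psi> y))) (- \<i> * of_real d * exp (- \<i> * of_real (\<psi> z))) i z"
  using has_pd_chain[OF DERIV_exp has_pd_cmult[OF has_pd_of_real[OF assms], of "- \<i>"]]
  by (simp add: mult_ac)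

lemma frame_inverse: "exp (\<i> * of_real p) / c * (c * exp (- \<i> * of_real p) * w) = w" if "c \<noteq> 0"
proof -
  have "exp (\<i> * of_real p) * exp (- \<i> * of_real p) = 1"
    by (simp add: exp_add[symmetric])
  moreover have "exp (\<i> * of_real p) / c * (c * exp (- \<i> * of_real p) * w)
      = exp (\<i> * of_real p) * exp (- \<i> * of_real p) * w"
    using that by (simp add: field_simps)
  ultimately show ?thesis by simp
qed

lemma nabla_cong_open:
  assumes "has_pd f d i z" "open S" "z \<in> S" "\<And>y. y \<in> S \<Longrightarrow> f y = g y"
  shows "nabla s i g z = nabla s i f z"
  using pd_eq[OF assms(1)] pd_eq[OF has_pd_cong_open[OF assms]] assms(3,4) by (simp add: nabla_def)

text \<open>Used to pass from \<open>U\<close>, where \<open>s\<close> is smooth, to all of space-time.\<close>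

lemma eq_on_dense:
  fixes f g :: "'a::topological_space \<Rightarrow> 'b::t2_space"
  assumes "continuous_on UNIV f" "continuous_on UNIV g" "closure U = UNIV" "\<And>z. z \<in> U \<Longrightarrow> f z = g z"
  shows "f z = g z"
proof -
  have "closed {z. f z = g z}" using assms(1,2) by (intro closed_Collect_eq)
  then have "closure U \<subseteq> {z. f z = g z}" using assms(4) by (intro closure_minimal) auto
  then show ?thesis using assms(3) by auto
qed

locale schroedinger_frame =
  fixes U :: "'n::finite spacetime set"
    and s :: "'n spacetime \<Rightarrow> complex"
    and \<psi> :: "'n spacetime \<Rightarrow> real"
    and u :: "'n option \<Rightarrow> 'n spacetime \<Rightarrow> complex"
    and a :: "'n option \<Rightarrow> 'n spacetime \<Rightarrow> real"
  assumes U: "open U" and dense: "closure U = UNIV"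
    and s: "Cm_on 4 U s" and \<psi>: "Cm_on 4 U \<psi>"
    and u: "\<And>i. Cm_on 3 UNIV (u i)" and a: "\<And>i. Cm_on 3 UNIV (a i)"
    and eqn: "schroedinger_map_on U s" and fields: "frame_fields_on U s \<psi> u a"
begin

lemma u_on: "z \<in> U \<Longrightarrow> u i z = exp (\<i> * of_real (\<psi> z)) / conf s z * pd i s z"
  using fields unfolding frame_fields_on_def by blast

lemma covD_on: "z \<in> U \<Longrightarrow> w differentiable (at z) \<Longrightarrow>
   covD a i w z = exp (\<i> * of_real (\<psi> z)) / conf s z
          * nabla s i (\<lambda>y. conf s y * exp (- \<i> * of_real (\<psi> y)) * w y) z"
  using fields unfolding frame_fields_on_def by simp

lemma s_pd: "z \<in> U \<Longrightarrow> has_pd s (pd i s z) i z"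
  using Cm_has_pd[of 3 U s z i] s U by (simp add: eval_nat_numeral)

lemma s_pd2: "z \<in> U \<Longrightarrow> has_pd (pd j s) (pd i (pd j s) z) i z"
  using Cm_has_pd[of 2 U "pd j s" z i] Cm_numeral(4)[OF s] U by (simp add: eval_nat_numeral)

lemma \<psi>_pd: "z \<in> U \<Longrightarrow> has_pd \<psi> (pd i \<psi> z) i z"
  using Cm_has_pd[of 3 U \<psi> z i] \<psi> U by (simp add: eval_nat_numeral)

lemma \<psi>_pd2: "z \<in> U \<Longrightarrow> has_pd (pd j \<psi>) (pd i (pd j \<psi>) z) i z"
  using Cm_has_pd[of 2 U "pd j \<psi>" z i] Cm_numeral(4)[OF \<psi>] U by (simp add: eval_nat_numeral)

lemma s_swap: "z \<in> U \<Longrightarrow> pd i (pd j s) z = pd j (pd i s) z"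
  using pd_commute[OF Cm_numeral(2)[OF Cm_numeral(1)[OF s]] U] .

lemma \<psi>_swap: "z \<in> U \<Longrightarrow> pd i (pd j \<psi>) z = pd j (pd i \<psi>) z"
  using pd_commute[OF Cm_numeral(2)[OF Cm_numeral(1)[OF \<psi>]] U] .

lemma u1: "Cm_on 1 UNIV (u i)" and u2: "Cm_on 2 UNIV (u i)"
  and a1: "Cm_on 1 UNIV (a i)" and a2: "Cm_on 2 UNIV (a i)"
  using Cm_numeral(2)[OF u] Cm_numeral(2)[OF a] Cm_numeral(3) by blast+

lemma has_pd1:
  fixes f :: "'n spacetime \<Rightarrow> 'b::real_normed_vector"
  shows "Cm_on 1 UNIV f \<Longrightarrow> has_pd f (pd i f z) i z"
  using Cm_has_pd_UNIV[of 0 f i z] by simp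

text \<open>Applying the frame identity to the components of the frame undoes the frame.\<close>

lemma covD_u_on:
  assumes z: "z \<in> U"
  shows "covD a i (u k) z = exp (\<i> * of_real (\<psi> z)) / conf s z * nabla s i (pd k s) z"
proof -
  have "u k differentiable (at z)" using u1[of k] by (simp add: One_nat_def Cm_on.simps(2) differentiable_on_def del: split_paired_All)
  from covD_on[OF z this]
  have "covD a i (u k) z = exp (\<i> * of_real (\<psi> z)) / conf s z
          * nabla s i (\<lambda>y. conf s y * exp (- \<i> * of_real (\<psi> y)) * u k y) z" .
  also have "nabla s i (\<lambda>y. conf s y * exp (- \<i> * of_real (\<psi> y)) * u k y) z = nabla s i (pd k s) z"
  proof (rule nabla_cong_open[OF s_pd2[OF z] U z])
    fix y assume y: "y \<in> U"
    have "conf s y * exp (- \<i> * of_real (\<psi> y)) * u k y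
        = exp (\<i> * of_real (\<psi> y)) / conf s y * (conf s y * exp (- \<i> * of_real (\<psi> y)) * pd k s y)"
      by (simp add: u_on[OF y] mult_ac)
    then show "pd k s y = conf s y * exp (- \<i> * of_real (\<psi> y)) * u k y"
      by (simp only: frame_inverse[OF conf_nonzero])
  qed
  finally show ?thesis .
qed

lemma continuous_covD:
  assumes "Cm_on 1 UNIV w"
  shows "continuous_on UNIV (covD a i w)"
proof -
  have "continuous_on UNIV (pd i w)" using Cm_continuous[OF Cm_pd[of 0 UNIV w i]] assms by simp
  then show ?thesis
    unfolding covD_def[abs_def]
    by (intro continuous_intros Cm_continuous[OF assms] Cm_continuous[OF a])
qed

text \<open>The covariant derivative of \<open>\<partial>\<^sub>k s\<close> along \<open>\<partial>\<^sub>i\<close> is symmetric in \<open>i\<close> and \<open>k\<close>.\<close>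

lemma torsion_free: "covD a i (u k) z = covD a k (u i) z"
proof (rule eq_on_dense[OF continuous_covD[OF u1] continuous_covD[OF u1] dense])
  fix z assume z: "z \<in> U"
  show "covD a i (u k) z = covD a k (u i) z"
    unfolding covD_u_on[OF z] by (simp add: nabla_def s_swap[OF z, of i k] mult_ac)
qed

lemma u_time: "u None z = \<i> * (\<Sum>j\<in>UNIV. covD a (Some j) (u (Some j)) z)"
proof (rule eq_on_dense[OF Cm_continuous[OF u] _ dense])
  show "continuous_on UNIV (\<lambda>z. \<i> * (\<Sum>j\<in>UNIV. covD a (Some j) (u (Some j)) z))"
    by (intro continuous_intros continuous_covD u1)
  fix z assume z: "z \<in> U"
  have "pd None s z = \<i> * (\<Sum>j\<in>UNIV. nabla s (Some j) (pd (Some j) s) z)"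
    using eqn z unfolding schroedinger_map_on_def by blast
  then show "u None z = \<i> * (\<Sum>j\<in>UNIV. covD a (Some j) (u (Some j)) z)"
    by (simp add: u_on[OF z] covD_u_on[OF z] sum_distrib_left mult_ac)
qed

text \<open>Evaluating the frame identity on the constant function \<open>1\<close> yields the connection coefficients. The identity is stated
  without denominators so that it can be differentiated as a polynomial one.\<close>

lemma connection_on:
  assumes z: "z \<in> U"
  shows "\<i> * of_real (a i z) * conf s z
    = s z * cnj (pd i s z) - cnj (s z) * pd i s z - \<i> * of_real (pd i \<psi> z) * conf s z"
proof -
  define e where "e = exp (- \<i> * of_real (\<psi> z))"
  let ?c = "conf s z" and ?ci = "s z * cnj (pd i s z) + pd i s z * cnj (s z)"
  have g: "has_pd (\<lambda>y. conf s y * exp (- \<i> * of_real (\<psi> y)) * 1)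
     (?c * e * 0 + (?c * (- \<i> * of_real (pd i \<psi> z) * e) + ?ci * e) * 1) i z"
    unfolding e_def by (intro has_pd_mult has_pd_const has_pd_conf has_pd_phase s_pd[OF z] \<psi>_pd[OF z])
  have "\<i> * of_real (a i z) = covD a i (\<lambda>_. 1) z"
    by (simp add: covD_def pd_eq[OF has_pd_const])
  also have "\<dots> = exp (\<i> * of_real (\<psi> z)) / ?c * nabla s i (\<lambda>y. conf s y * exp (- \<i> * of_real (\<psi> y)) * 1) z"
    by (rule covD_on[OF z]) simp
  also have "nabla s i (\<lambda>y. conf s y * exp (- \<i> * of_real (\<psi> y)) * 1) z
      = ?c * e * (?ci / ?c - \<i> * of_real (pd i \<psi> z) - 2 * cnj (s z) * pd i s z / ?c)"
    unfolding nabla_def pd_eq[OF g] e_def[symmetric] using conf_nonzero[of s z] by (simp add: field_simps)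
  also have "exp (\<i> * of_real (\<psi> z)) / ?c * \<dots> = ?ci / ?c - \<i> * of_real (pd i \<psi> z) - 2 * cnj (s z) * pd i s z / ?c"
    unfolding e_def by (rule frame_inverse[OF conf_nonzero])
  finally have "\<i> * of_real (a i z) * ?c = (?ci / ?c - \<i> * of_real (pd i \<psi> z) - 2 * cnj (s z) * pd i s z / ?c) * ?c"
    by simp
  also have "\<dots> = ?ci - \<i> * of_real (pd i \<psi> z) * ?c - 2 * cnj (s z) * pd i s z"
    using conf_nonzero[of s z] by (simp add: left_diff_distrib)
  finally show ?thesis by (simp add: algebra_simps)
qed

text \<open>In the antisymmetrised derivative of \<open>connection_on\<close> the phase and the second derivatives of \<open>s\<close>
  cancel. What remains is the area form of the sphere, with density \<open>4 / (1 + |s|\<^sup>2)\<^sup>2\<close>, pulled back by \<open>s\<close>, up to sign.\<close>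

lemma curvature_on:
  assumes z: "z \<in> U"
  shows "pd i (a j) z - pd j (a i) z = 4 * Im (u i z * cnj (u j z))"
proof -
  define S where "S = s z" define T where "T = cnj (s z)"
  define c where "c = conf s z"
  define cp where "cp i = S * cnj (pd i s z) + pd i s z * T" for i
  have c: "c = 1 + S * T" "c \<noteq> 0" by (simp_all add: c_def S_def T_def conf_eq[symmetric] conf_nonzero)
  have conf': "has_pd (conf s) (cp i) i z" for i
    unfolding cp_def S_def T_def by (rule has_pd_conf[OF s_pd[OF z]])
  have deriv: "\<i> * of_real (a i z) * cp j + \<i> * of_real (pd j (a i) z) * c
     = S * cnj (pd j (pd i s) z) + pd j s z * cnj (pd i s z)
       - (T * pd j (pd i s) z + cnj (pd j s z) * pd i s z)
       - (\<i> * of_real (pd i \<psi> z) * cp j + \<i> * of_real (pd j (pd i \<psi>) z) * c)" for i j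
  proof -
    have 1: "has_pd (\<lambda>z. \<i> * of_real (a i z) * conf s z)
        (\<i> * of_real (a i z) * cp j + \<i> * of_real (pd j (a i) z) * conf s z) j z"
      by (intro has_pd_mult[OF _ conf'] has_pd_cmult has_pd_of_real has_pd1 a1)
    have 2: "has_pd (\<lambda>z. s z * cnj (pd i s z) - cnj (s z) * pd i s z - \<i> * of_real (pd i \<psi> z) * conf s z)
        (s z * cnj (pd j (pd i s) z) + pd j s z * cnj (pd i s z)
         - (cnj (s z) * pd j (pd i s) z + cnj (pd j s z) * pd i s z)
         - (\<i> * of_real (pd i \<psi> z) * cp j + \<i> * of_real (pd j (pd i \<psi>) z) * conf s z)) j z"
      by (intro has_pd_diff has_pd_mult[OF _ conf'] has_pd_mult[OF s_pd[OF z]] has_pd_mult[OF has_pd_cnj[OF s_pd[OF z]]]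
         has_pd_cmult has_pd_of_real has_pd_cnj s_pd2[OF z] \<psi>_pd2[OF z])
    from pd_eq[OF has_pd_cong_open[OF 2 U z connection_on[symmetric]]] pd_eq[OF 1]
    show ?thesis by (simp add: S_def T_def c_def)
  qed
  have conn: "\<i> * of_real (a i z) * c = S * cnj (pd i s z) - T * pd i s z - \<i> * of_real (pd i \<psi> z) * c" for i
    using connection_on[OF z] by (simp add: S_def T_def c_def)
  \<comment> \<open>With the gradient of the phase absorbed, the connection depends on \<open>s\<close> and its gradient only.\<close>
  define A where "A i = \<i> * complex_of_real (a i z) + \<i> * of_real (pd i \<psi> z)" for i
  have A: "A i * c = S * cnj (pd i s z) - T * pd i s z" for i
    using conn[of i] by (simp add: A_def algebra_simps)
  have "\<i> * of_real (pd i (a j) z - pd j (a i) z) * c = A i * cp j - A j * cp i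
      + 2 * (pd i s z * cnj (pd j s z) - pd j s z * cnj (pd i s z))"
    using deriv[of i j] deriv[of j i, unfolded s_swap[OF z, of i j] \<psi>_swap[OF z, of i j]]
    unfolding A_def of_real_diff by algebra
  then have "\<i> * of_real (pd i (a j) z - pd j (a i) z) * c * c = (A i * c) * cp j - (A j * c) * cp i
      + 2 * (pd i s z * cnj (pd j s z) - pd j s z * cnj (pd i s z)) * c"
    by algebra
  also have "\<dots> = 2 * (pd i s z * cnj (pd j s z) - pd j s z * cnj (pd i s z))"
    unfolding A cp_def unfolding c(1) by (simp add: algebra_simps)
  also have "\<dots> = 4 * \<i> * of_real (Im (pd i s z * cnj (pd j s z)))"
    by (simp add: complex_eq_iff)
  also have "\<dots> = 4 * \<i> * of_real (Im (u i z * cnj (u j z))) * c * c"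
  proof -
    have cc: "cnj c = c" by (simp add: c_def conf_def)
    \<comment> \<open>The phase drops out of \<open>u\<^sub>i cnj u\<^sub>j\<close>, leaving the square of the conformal factor.\<close>
    have e: "cmod (exp (\<i> * of_real (\<psi> z))) = 1" by (simp add: norm_exp_i_times)
    have ee: "exp (\<i> * of_real (\<psi> z)) * cnj (exp (\<i> * of_real (\<psi> z))) = 1"
      using e by (simp add: complex_norm_square[symmetric])
    have "u i z * cnj (u j z) * (c * c) = (exp (\<i> * of_real (\<psi> z)) * cnj (exp (\<i> * of_real (\<psi> z))))
        * (pd i s z * cnj (pd j s z)) * (c / c) * (c / c)"
      unfolding u_on[OF z] c_def[symmetric] complex_cnj_mult complex_cnj_divide cc by (simp add: field_simps)
    then have 1: "u i z * cnj (u j z) * (c * c) = pd i s z * cnj (pd j s z)"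
      using c(2) by (simp add: ee)
    define r where "r = 1 + (cmod (s z))\<^sup>2"
    have r: "c = of_real r" by (simp add: c_def conf_def r_def)
    have "Im (u i z * cnj (u j z) * (c * c)) = Im (u i z * cnj (u j z)) * (r * r)"
      unfolding r of_real_mult[symmetric] by simp
    then have I: "Im (pd i s z * cnj (pd j s z)) = Im (u i z * cnj (u j z)) * (r * r)"
      by (simp only: 1)
    show ?thesis unfolding I r by (simp only: of_real_mult mult.assoc)
  qed
  finally have "\<i> * of_real (pd i (a j) z - pd j (a i) z) = 4 * \<i> * of_real (Im (u i z * cnj (u j z)))"
    using c(2) by simp
  then have "of_real (pd i (a j) z - pd j (a i) z) = (of_real (4 * Im (u i z * cnj (u j z))) :: complex)"
    by simp
  then show ?thesis by (simp only: of_real_eq_iff)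
qed

lemma curvature: "pd i (a j) z - pd j (a i) z = 4 * Im (u i z * cnj (u j z))"
proof (rule eq_on_dense[OF _ _ dense curvature_on])
  have c: "continuous_on UNIV (pd k (a l))" for k l
    using Cm_continuous[OF Cm_numeral(6)[OF a2]] .
  show "continuous_on UNIV (\<lambda>z. pd i (a j) z - pd j (a i) z)" by (intro continuous_intros c)
  show "continuous_on UNIV (\<lambda>z. 4 * Im (u i z * cnj (u j z)))"
    by (intro continuous_intros Cm_continuous[OF u])
qed

section \<open>The modified equations\<close>

lemma has_pd_covD:
  assumes w: "Cm_on 2 UNIV w"
  shows "has_pd (covD a k w) (pd i (pd k w) z + \<i> * (of_real (a k z) * pd i w z + of_real (pd i (a k) z) * w z)) i z"
proof -
  note w1 = Cm_numeral(3)[OF w] and w2 = Cm_numeral(6)[OF w]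
  have "has_pd (\<lambda>z. pd k w z + \<i> * (of_real (a k z) * w z))
     (pd i (pd k w) z + \<i> * (of_real (a k z) * pd i w z + of_real (pd i (a k) z) * w z)) i z"
    by (intro has_pd_add has_pd_cmult has_pd_mult has_pd_of_real has_pd1 w1 w2 a1)
  then show ?thesis by (simp add: covD_def[abs_def] mult.assoc)
qed

lemma commutator:
  assumes w: "Cm_on 2 UNIV w"
  shows "covD a j (covD a k w) z = covD a k (covD a j w) z + \<i> * of_real (pd j (a k) z - pd k (a j) z) * w z"
proof -
  have E: "covD a j (covD a k w) z = pd j (pd k w) z + \<i> * (of_real (a k z) * pd j w z + of_real (pd j (a k) z) * w z)
     + \<i> * of_real (a j z) * (pd k w z + \<i> * of_real (a k z) * w z)" for j k
    unfolding covD_def[of a j] pd_eq[OF has_pd_covD[OF w]] by (simp add: covD_def)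
  show ?thesis unfolding E[of j k] E[of k j] pd_swap[OF w, of j k] of_real_diff by (simp add: algebra_simps)
qed

text \<open>Each summand of \<open>D\<^sub>0 u\<^sub>j = D\<^sub>j u\<^sub>0 = \<i> \<Sum> D\<^sub>j D\<^sub>k u\<^sub>k\<close> is expanded after moving \<open>D\<^sub>j\<close> to \<open>u\<^sub>k\<close> and using the torsion identity.\<close>

lemma evolution:
  assumes gauge: "(\<Sum>k\<in>UNIV. pd (Some k) (a (Some k)) z) = 0"
  shows "pd None (u (Some j)) z =
        \<i> * lap (u (Some j)) z
        - 2 * (\<Sum>k\<in>UNIV. of_real (a (Some k) z) * pd (Some k) (u (Some j)) z)
        - \<i> * of_real (\<Sum>k\<in>UNIV. (a (Some k) z)\<^sup>2) * u (Some j) z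
        + 4 * (\<Sum>k\<in>UNIV. of_real (Im (cnj (u (Some j) z) * u (Some k) z)) * u (Some k) z)
        - \<i> * of_real (a None z) * u (Some j) z"
proof -
  let ?D = "\<lambda>k. covD a (Some k)" and ?v = "\<lambda>k. u (Some k)"
  have D1: "has_pd (?D k (?v k)) (pd i (?D k (?v k)) z) i z" for i k
    using has_pd_covD[OF u2] pd_eq by metis
  have "pd (Some j) (u None) z = \<i> * (\<Sum>k\<in>UNIV. pd (Some j) (?D k (?v k)) z)"
  proof -
    have "u None = (\<lambda>z. \<i> * (\<Sum>k\<in>UNIV. ?D k (?v k) z))" using u_time by blast
    then show ?thesis by (simp add: pd_eq[OF has_pd_cmult[OF has_pd_sum[OF D1]]])
  qed
  then have Du: "covD a (Some j) (u None) z = \<i> * (\<Sum>k\<in>UNIV. ?D j (?D k (?v k)) z)"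
    unfolding covD_def[of a "Some j"] u_time by (simp add: sum.distrib sum_distrib_left algebra_simps)
  have step: "\<i> * ?D j (?D k (?v k)) z
     = \<i> * pd (Some k) (pd (Some k) (?v j)) z - 2 * (of_real (a (Some k) z) * pd (Some k) (?v j) z)
       - of_real (pd (Some k) (a (Some k)) z) * ?v j z
       - \<i> * of_real ((a (Some k) z)\<^sup>2) * ?v j z
       + 4 * (of_real (Im (cnj (?v j z) * ?v k z)) * ?v k z)" for k
  proof -
    define m where "m = Im (cnj (?v j z) * ?v k z)"
    have m: "Im (?v j z * cnj (?v k z)) = - m" by (simp add: m_def)
    have "?D j (?v k) = ?D k (?v j)" using torsion_free by blast
    then have e1: "?D j (?D k (?v k)) z = ?D k (?D k (?v j)) z + \<i> * of_real (4 * - m) * ?v k z"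
      unfolding commutator[OF u2, of "Some j" "Some k"] curvature m by simp
    have e2: "?D k (?D k (?v j)) z = pd (Some k) (pd (Some k) (?v j)) z
       + \<i> * (of_real (a (Some k) z) * pd (Some k) (?v j) z + of_real (pd (Some k) (a (Some k)) z) * ?v j z)
       + \<i> * of_real (a (Some k) z) * (pd (Some k) (?v j) z + \<i> * of_real (a (Some k) z) * ?v j z)"
      unfolding covD_def[of a "Some k" "?D k (?v j)"] pd_eq[OF has_pd_covD[OF u2]] by (simp add: covD_def)
    show ?thesis
      unfolding m_def[symmetric] e1 e2 by (simp add: algebra_simps power2_eq_square)
  qed
  have "covD a None (?v j) z = covD a (Some j) (u None) z" by (rule torsion_free)
  also have "\<dots> = (\<Sum>k\<in>UNIV. \<i> * ?D j (?D k (?v k)) z)" by (simp only: Du sum_distrib_left)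
  also have "\<dots> = \<i> * lap (?v j) z - 2 * (\<Sum>k\<in>UNIV. of_real (a (Some k) z) * pd (Some k) (?v j) z)
       - of_real (\<Sum>k\<in>UNIV. pd (Some k) (a (Some k)) z) * ?v j z
       - \<i> * of_real (\<Sum>k\<in>UNIV. (a (Some k) z)\<^sup>2) * ?v j z
       + 4 * (\<Sum>k\<in>UNIV. of_real (Im (cnj (?v j z) * ?v k z)) * ?v k z)"
    unfolding step sum.distrib sum_subtractf lap_def of_real_sum sum_distrib_left sum_distrib_right ..
  finally show ?thesis by (simp add: covD_def gauge algebra_simps)
qed

text \<open>By the equation the left hand side is \<open>- \<Sum> Re (u\<^sub>k cnj (D\<^sub>j u\<^sub>j))\<close>. The product rule for \<open>D\<^sub>j\<close> and
  \<open>D\<^sub>j u\<^sub>k = D\<^sub>k u\<^sub>j\<close> write it as a divergence.\<close>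

lemma energy_flux:
  "Im (u (Some k) z * cnj (u None z)) = - (\<Sum>j\<in>UNIV.
      pd (Some j) (\<lambda>y. Re (u (Some k) y * cnj (u (Some j) y))) z
      - 1 / 2 * pd (Some k) (\<lambda>y. Re (u (Some j) y * cnj (u (Some j) y))) z)"
proof -
  have R: "pd i (\<lambda>y. Re (u k y * cnj (u j y))) z = Re (covD a i (u k) z * cnj (u j z)) + Re (u k z * cnj (covD a i (u j) z))" for i k j
  proof -
    have "has_pd (\<lambda>y. Re (u k y * cnj (u j y))) (Re (u k z * cnj (pd i (u j) z) + pd i (u k) z * cnj (u j z))) i z"
      by (intro has_pd_Re has_pd_mult has_pd_cnj has_pd1 u1)
    from pd_eq[OF this] show ?thesis by (simp add: covD_def algebra_simps)
  qed
  have sym: "Re (x * cnj y) = Re (y * cnj x)" for x y by simp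
  have "Re (u (Some k) z * cnj (covD a (Some j) (u (Some j)) z))
     = pd (Some j) (\<lambda>y. Re (u (Some k) y * cnj (u (Some j) y))) z
      - 1 / 2 * pd (Some k) (\<lambda>y. Re (u (Some j) y * cnj (u (Some j) y))) z" for j
    using R[of "Some j" "Some k" "Some j"] R[of "Some k" "Some j" "Some j"]
      sym[of "u (Some j) z" "covD a (Some k) (u (Some j)) z"]
    unfolding torsion_free[of "Some j" "Some k"] by linarith
  moreover have "Im (u (Some k) z * cnj (u None z)) = - (\<Sum>j\<in>UNIV. Re (u (Some k) z * cnj (covD a (Some j) (u (Some j)) z)))"
  proof -
    have 1: "u (Some k) z * cnj (u None z) = - (\<i> * (\<Sum>j\<in>UNIV. u (Some k) z * cnj (covD a (Some j) (u (Some j)) z)))"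
      by (simp add: u_time sum_distrib_left sum_negf mult_ac)
    have 2: "Im (- (\<i> * x)) = - Re x" for x by simp
    show ?thesis by (simp only: 1 2 Re_sum)
  qed
  ultimately show ?thesis by (simp only:)
qed

text \<open>Taking the spatial divergence of the curvature identity \<open>\<partial>\<^sub>k a\<^sub>0 - \<partial>\<^sub>0 a\<^sub>k\<close>, the gauge condition removes the
  second term.\<close>

lemma temporal_potential:
  assumes gauge: "\<And>z. (\<Sum>k\<in>UNIV. pd (Some k) (a (Some k)) z) = 0"
  shows "lap (a None) z =
        - 4 * (\<Sum>j\<in>UNIV. \<Sum>k\<in>UNIV.
            pd (Some k) (pd (Some j) (\<lambda>y. Re (u (Some k) y * cnj (u (Some j) y)))) z
            - 1 / 2 * pd (Some k) (pd (Some k) (\<lambda>y. Re (u (Some j) y * cnj (u (Some j) y)))) z)"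
proof -
  define R where "R k j = (\<lambda>y. Re (u (Some k) y * cnj (u (Some j) y)))" for k j
  have R: "Cm_on 2 UNIV (R k j)" for k j
    unfolding R_def by (intro Cm_linear[OF bounded_linear_Re] Cm_mult u2 Cm_linear[OF bounded_linear_cnj])
  define F where "F k = (\<lambda>z. \<Sum>j\<in>UNIV. pd (Some j) (R k j) z - 1 / 2 * pd (Some k) (R j j) z)" for k
  have F: "has_pd (F k) (\<Sum>j\<in>UNIV. pd (Some k) (pd (Some j) (R k j)) z - 1 / 2 * pd (Some k) (pd (Some k) (R j j)) z) (Some k) z" for k z
    unfolding F_def by (intro has_pd_sum has_pd_diff has_pd_cmult has_pd1 Cm_numeral(6)[OF R])
  have "pd (Some k) (a None) = (\<lambda>z. pd None (a (Some k)) z + (- 4) * F k z)" for k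
  proof
    fix z
    show "pd (Some k) (a None) z = pd None (a (Some k)) z + (- 4) * F k z"
      using curvature[of "Some k" None z] unfolding energy_flux R_def[symmetric] F_def by simp
  qed
  then have "pd (Some k) (pd (Some k) (a None)) z = pd (Some k) (pd None (a (Some k))) z
      + (- 4) * (\<Sum>j\<in>UNIV. pd (Some k) (pd (Some j) (R k j)) z - 1 / 2 * pd (Some k) (pd (Some k) (R j j)) z)" for k
    by (simp only:) (intro pd_eq has_pd_add has_pd1 Cm_numeral(6)[OF a2] has_pd_cmult F)
  then have "lap (a None) z = (\<Sum>k\<in>UNIV. pd (Some k) (pd None (a (Some k))) z)
     + (- 4) * (\<Sum>k\<in>UNIV. \<Sum>j\<in>UNIV. pd (Some k) (pd (Some j) (R k j)) z - 1 / 2 * pd (Some k) (pd (Some k) (R j j)) z)"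
    unfolding lap_def by (simp only: sum.distrib sum_distrib_left)
  also have "(\<Sum>k\<in>UNIV. pd (Some k) (pd None (a (Some k))) z) = pd None (\<lambda>z. \<Sum>k\<in>UNIV. pd (Some k) (a (Some k)) z) z"
    unfolding pd_swap[OF a2, of _ None] by (subst pd_sum) (rule Cm_numeral(6)[OF a2] refl)+
  also have "\<dots> = 0" by (simp add: gauge pd_eq[OF has_pd_const])
  finally show ?thesis unfolding R_def by (subst sum.swap) simp
qed

end

theorem theorem2:
  fixes U :: "'n::finite spacetime set"
    and s :: "'n spacetime \<Rightarrow> complex"
    and \<psi> :: "'n spacetime \<Rightarrow> real"
    and u :: "'n option \<Rightarrow> 'n spacetime \<Rightarrow> complex"
    and a :: "'n option \<Rightarrow> 'n spacetime \<Rightarrow> real"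
  assumes "open U" and "closure U = UNIV"
    and "Cm_on 4 U s" and "Cm_on 4 U \<psi>"
    and "\<And>i. Cm_on 3 UNIV (u i)" and "\<And>i. Cm_on 3 UNIV (a i)"
    and schroedinger_map: "schroedinger_map_on U s"
    and fields: "frame_fields_on U s \<psi> u a"
    and finite_energy: "\<And>t. integrable lborel (\<lambda>x. \<Sum>j\<in>UNIV. (cmod (u (Some j) (t, x)))\<^sup>2)"
    and s_at_infinity: "\<And>t e. e > 0 \<Longrightarrow> \<exists>R. \<forall>x. (t, x) \<in> U \<longrightarrow> R \<le> norm x \<longrightarrow> cmod (s (t, x)) < e"
    and gauge: "\<And>z. (\<Sum>j\<in>UNIV. pd (Some j) (a (Some j)) z) = 0"
    and a_at_infinity: "\<And>i. Cm_vanishes_at_infinity 3 (a i)"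
  shows
    "(\<forall>j z. pd None (u (Some j)) z =
        \<i> * lap (u (Some j)) z
        - 2 * (\<Sum>k\<in>UNIV. of_real (a (Some k) z) * pd (Some k) (u (Some j)) z)
        - \<i> * of_real (\<Sum>k\<in>UNIV. (a (Some k) z)\<^sup>2) * u (Some j) z
        + 4 * (\<Sum>k\<in>UNIV. of_real (Im (cnj (u (Some j) z) * u (Some k) z)) * u (Some k) z)
        - \<i> * of_real (a None z) * u (Some j) z)
     \<and> (\<exists>\<kappa> :: 'n option \<Rightarrow> 'n option \<Rightarrow> 'n spacetime \<Rightarrow> real.
          (\<forall>k j. Cm_on 2 UNIV (\<kappa> k j))
        \<and> (\<forall>k j z. \<kappa> k j z = - \<kappa> j k z)
        \<and> (\<forall>k z. a k z = (\<Sum>l\<in>UNIV. pd (Some l) (\<kappa> (Some l) k) z))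
        \<and> (\<forall>i j k z. pd i (\<kappa> j k) z + pd j (\<kappa> k i) z + pd k (\<kappa> i j) z = 0)
        \<and> (\<forall>k j z. lap (\<kappa> (Some k) j) z = 4 * Im (u (Some k) z * cnj (u j z))))
     \<and> (\<forall>z. lap (a None) z =
        - 4 * (\<Sum>j\<in>UNIV. \<Sum>k\<in>UNIV.
            pd (Some k) (pd (Some j) (\<lambda>y. Re (u (Some k) y * cnj (u (Some j) y)))) z
            - 1 / 2 * pd (Some k) (pd (Some k) (\<lambda>y. Re (u (Some j) y * cnj (u (Some j) y)))) z))"
proof -
  interpret schroedinger_frame U s \<psi> u a
    by unfold_locales (fact assms)+
  have decay: "Cm_decaying 3 (a i)" for i
    unfolding Cm_decaying_def using a a_at_infinity by blast
  obtain \<kappa> :: "'n option \<Rightarrow> 'n option \<Rightarrow> 'n spacetime \<Rightarrow> real" where \<kappa>: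
    "\<And>k j. Cm_on 2 UNIV (\<kappa> k j)"
    "\<And>k j z. \<kappa> k j z = - \<kappa> j k z"
    "\<And>k z. a k z = (\<Sum>l\<in>UNIV. pd (Some l) (\<kappa> (Some l) k) z)"
    "\<And>i j k z. pd i (\<kappa> j k) z + pd j (\<kappa> k i) z + pd k (\<kappa> i j) z = 0"
    "\<And>k j z. lap (\<kappa> k j) z = pd k (a j) z - pd j (a k) z"
    using closed_two_form[OF decay gauge] by blast
  have "lap (\<kappa> (Some k) j) z = 4 * Im (u (Some k) z * cnj (u j z))" for k j z
    using \<kappa>(5)[of "Some k" j z] curvature[of "Some k" j z] by (simp only:)
  note \<kappa>_all = \<kappa>(1-4) this
  show ?thesis
  proof (intro conjI allI exI[of _ \<kappa>])
    fix j z
    show "pd None (u (Some j)) z =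
        \<i> * lap (u (Some j)) z
        - 2 * (\<Sum>k\<in>UNIV. of_real (a (Some k) z) * pd (Some k) (u (Some j)) z)
        - \<i> * of_real (\<Sum>k\<in>UNIV. (a (Some k) z)\<^sup>2) * u (Some j) z
        + 4 * (\<Sum>k\<in>UNIV. of_real (Im (cnj (u (Some j) z) * u (Some k) z)) * u (Some k) z)
        - \<i> * of_real (a None z) * u (Some j) z"
      by (rule evolution[OF gauge])
  qed (rule \<kappa>_all temporal_potential[OF gauge])+
qed

end
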